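(* Let $(\mathcal A,\varphi,\psi,\theta)$ be a unital 3-algebraic probability space, and let $K_n^\alpha,K_n^\beta,K_n^\gamma$ be its $n$-th $\alpha$-free, $\beta$-free and $\gamma$-free cumulants. Then for all $n\ge1$ and $a_1,\dots,a_n\in\mathcal A$, $$\varphi(a_1\cdots a_n)=\sum_{\pi\in\mathcal{ONC}(n)}\frac1{|\pi|!}\Big[\prod_{P\in\mathscr O(\pi)}K^\alpha_{|P|}(a_P)\Big]\Big[\prod_{P\in\mathscr B(\pi)}K^\beta_{|P|}(a_P)\Big]\Big[\prod_{P\in\mathscr C(\pi)}K^\gamma_{|P|}(a_P)\Big],$$ $$\psi(a_1\cdots a_n)=\sum_{\pi\in\mathcal{ONC}(n)}\frac1{|\pi|!}\Big[\prod_{P\in\mathscr O(\pi)\cup\mathscr B(\pi)}K^\beta_{|P|}(a_P)\Big]\Big[\prod_{P\in\mathscr C(\pi)}K^\gamma_{|P|}(a_P)\Big],$$ $$\theta(a_1\cdots a_n)=\sum_{\pi\in\mathcal{ONC}(n)}\frac1{|\pi|!}\Big[\prod_{P\in\mathscr B(\pi)}K^\beta_{|P|}(a_P)\Big]\Big[\prod_{P\in\mathscr O(\pi)\cup\mathscr C(\pi)}K^\gamma_{|P|}(a_P)\Big].$$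
   Context: All algebras are over $\mathbb C$. A unital 3-algebraic probability space is a unital algebra with three unital linear functionals. **Ordered noncrossing partitions.** An ordered set partition of $[n]=\{1,\dots,n\}$ is a sequence $\pi=(P_1,\dots,P_p)$ of blocks such that $\{P_1,\dots,P_p\}$ is a set partition of $[n]$; $|\pi|=p$; $P_i$ precedes $P_j$ if $i<j$. $\mathcal{ONC}(n)$ is the set of ordered set partitions whose underlying set partition is noncrossing (no two distinct blocks $B,B'$ with $i<k<j<\ell$, $i,j\in B$, $k,\ell\in B'$). A block $P'$ covers $P$ if there are $i,j\in P'$ with $i<k<j$ for all $k\in P$. Blocks covered by some block are inner, the others outer; $\mathscr O(\pi)$ is the set of outer blocks. For an inner block $P$, $C(P)$ is its nearest cover: the unique block covering $P$ such that no block $P'$ covers $P$ and is covered by $C(P)$. $\mathscr B(\pi)$ is the set of inner blocks $P$ such that $C(P)$ precedes $P$; $\mathscr C(\pi)$ is the set of inner blocks $P$ that precede $C(P)$. For $P=\{p_1<\cdots<p_k\}$ and a multilinear functional $M_k$, $M_k(a_P):=M_k(a_{p_1},\dots,a_{p_k})$. **$\alpha$-free product.** For a totally ordered set $I$, $I^\ast$ is the set of finite sequences $\mathbf i=(i_1,\dots,i_n)$, $n\ge1$, in $I$ with $i_k\ne i_{k+1}$. $\mathrm{Peak}(\mathbf i)=\{k\in\{2,\dots,n-1\}: i_{k-1}<i_k>i_{k+1}\}$, $\mathrm{Bot}(\mathbf i)=\{k\in\{2,\dots,n-1\}: i_{k-1}>i_k<i_{k+1}\}$. Given unital 3-algebraic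 probability spaces $(\mathcal A_i,\varphi_i,\psi_i,\theta_i)$, define linear functionals on $\mathcal A_{i_k}$: $\alpha_{\mathbf i,1}=\varphi_{i_1}$, $\alpha_{\mathbf i,k}=\psi_{i_k}$ if $k\in\mathrm{Peak}(\mathbf i)$, $\theta_{i_k}$ if $k\in\mathrm{Bot}(\mathbf i)$, $0$ otherwise; $\beta_{\mathbf i,k}$ (resp. $\gamma_{\mathbf i,k}$) is defined in the same way with $\varphi_{i_1}$ replaced by $\psi_{i_1}$ (resp. $\theta_{i_1}$). The $\alpha$-free product $\leftthreetimes_{i\in I}(\mathcal A_i,\varphi_i,\psi_i,\theta_i)$ is the unique tuple $(\mathcal U,\widetilde\varphi,\widetilde\psi,\widetilde\theta)$ with $\mathcal U=\ast_{i\in I}\mathcal A_i$ the unital free product and unital linear functionals such that for every $\mathbf i\in I^\ast$ and $a_k\in\mathcal A_{i_k}$: $\widetilde\varphi(a_1\cdots a_n)=0$ if all $a_k\in\ker\alpha_{\mathbf i,k}$; $\widetilde\psi(a_1\cdots a_n)=0$ if all $a_k\in\ker\beta_{\mathbf i,k}$; $\widetilde\theta(a_1\cdots a_n)=0$ if all $a_k\in\ker\gamma_{\mathbf i,k}$. **Cumulants.** Let $(\mathcal U,\widetilde\varphi,\widetilde\psi,\widetilde\theta)$ be the $\alpha$-free product over $\mathbb N=\{1,2,\dots\}$ of copies of $(\mathcal A,\varphi,\psi,\theta)$, let $a\mapsto a^{(j)}$ be the embedding of $\mathcal A$ as the $j$-th copy, and $N.a:=a^{(1)}+\cdots+a^{(N)}$.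 For $a_1,\dots,a_n\in\mathcal A$, the quantities $\widetilde\varphi((N.a_1)\cdots(N.a_n))$, $\widetilde\psi((N.a_1)\cdots(N.a_n))$, $\widetilde\theta((N.a_1)\cdots(N.a_n))$ are polynomials in $N$ without constant term; the coefficients of $N^1$ are denoted $K_n^\alpha(a_1,\dots,a_n)$, $K_n^\beta(a_1,\dots,a_n)$, $K_n^\gamma(a_1,\dots,a_n)$, respectively. *)

theory Defs
  imports
    Complex_Main
    "HOL-Library.Poly_Mapping"
    "HOL-Library.Disjoint_Sets"
    "HOL-Computational_Algebra.Polynomial"
begin

section \<open>Unital complex algebras and unital linear functionals\<close>

class complex_algebra_1 = ring_1 +
  fixes scaleC :: "complex \<Rightarrow> 'a \<Rightarrow> 'a" (infixr \<open>*\<^sub>C\<close> 75)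
  assumes scaleC_add_right: "c *\<^sub>C (x + y) = c *\<^sub>C x + c *\<^sub>C y"
    and scaleC_add_left: "(c + d) *\<^sub>C x = c *\<^sub>C x + d *\<^sub>C x"
    and scaleC_scaleC: "c *\<^sub>C d *\<^sub>C x = (c * d) *\<^sub>C x"
    and scaleC_one: "1 *\<^sub>C x = x"
    and mult_scaleC_left: "(c *\<^sub>C x) * y = c *\<^sub>C (x * y)"
    and mult_scaleC_right: "x * (c *\<^sub>C y) = c *\<^sub>C (x * y)"

definition unital_functional :: "('a::complex_algebra_1 \<Rightarrow> complex) \<Rightarrow> bool" where
  "unital_functional f \<longleftrightarrow> Vector_Spaces.linear (*\<^sub>C) (*) f \<and> f 1 = 1"


section \<open>The unital free product of copies of an algebra\<close>

text \<open>Lists form the free monoid, so finitely supported functions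
  \<^typ>\<open>'b list \<Rightarrow>\<^sub>0 complex\<close> with convolution are the free unital complex algebra on \<^typ>\<open>'b\<close>.\<close>

instantiation list :: (type) monoid_add
begin
definition zero_list :: "'a list" where "zero_list = []"
definition plus_list :: "'a list \<Rightarrow> 'a list \<Rightarrow> 'a list" where "plus_list = (@)"
instance by standard (simp_all add: zero_list_def plus_list_def)
end

type_synonym ('i, 'a) free_alg = "('i \<times> 'a) list \<Rightarrow>\<^sub>0 complex"

definition letter :: "'i \<Rightarrow> 'a \<Rightarrow> ('i, 'a) free_alg" where
  "letter i a = Poly_Mapping.single [(i, a)] 1"

definition scalar :: "complex \<Rightarrow> ('i, 'a) free_alg" where
  "scalar c = Poly_Mapping.single [] c"

text \<open>The two-sided ideal that makes each \<^term>\<open>letter i\<close> a homomorphism of unital algebras.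
  (It contains \<open>0\<close> and is closed under negation by the rule \<open>mult\<close>.)\<close>

inductive_set free_product_ideal :: "('i, 'a::complex_algebra_1) free_alg set" where
  gen_add: "letter i (a + b) - (letter i a + letter i b) \<in> free_product_ideal"
| gen_scale: "letter i (c *\<^sub>C a) - scalar c * letter i a \<in> free_product_ideal"
| gen_mult: "letter i (a * b) - letter i a * letter i b \<in> free_product_ideal"
| gen_one: "letter i 1 - 1 \<in> free_product_ideal"
| add: "x \<in> free_product_ideal \<Longrightarrow> y \<in> free_product_ideal \<Longrightarrow> x + y \<in> free_product_ideal"
| mult: "x \<in> free_product_ideal \<Longrightarrow> u * x * v \<in> free_product_ideal"

lemma free_product_ideal_0: "0 \<in> free_product_ideal"
  using free_product_ideal.mult[OF free_product_ideal.gen_one, of 0 _ 0] by simp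

lemma free_product_ideal_mult_left: "x \<in> free_product_ideal \<Longrightarrow> u * x \<in> free_product_ideal"
  using free_product_ideal.mult[of x u 1] by simp

lemma free_product_ideal_mult_right: "x \<in> free_product_ideal \<Longrightarrow> x * v \<in> free_product_ideal"
  using free_product_ideal.mult[of x 1 v] by simp

lemma free_product_ideal_uminus: "x \<in> free_product_ideal \<Longrightarrow> - x \<in> free_product_ideal"
  using free_product_ideal_mult_left[of x "-1"] by simp

lemma free_product_ideal_minus:
  "x \<in> free_product_ideal \<Longrightarrow> y \<in> free_product_ideal \<Longrightarrow> x - y \<in> free_product_ideal"
  using free_product_ideal.add[of x "- y"] free_product_ideal_uminus[of y] by simp

text \<open>\<open>('i, 'a) free_product\<close> is the unital free product of the family, indexed by \<open>'i\<close>,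
  all of whose members are \<open>'a\<close>.\<close>

quotient_type (overloaded) ('i, 'a) free_product = "('i, 'a::complex_algebra_1) free_alg" /
  "\<lambda>x y. x - y \<in> free_product_ideal"
proof (rule equivpI)
  show "reflp (\<lambda>x y :: ('i, 'a) free_alg. x - y \<in> free_product_ideal)"
    by (simp add: reflp_def free_product_ideal_0)
  show "symp (\<lambda>x y :: ('i, 'a) free_alg. x - y \<in> free_product_ideal)"
    unfolding symp_def using free_product_ideal_uminus by (metis minus_diff_eq)
  show "transp (\<lambda>x y :: ('i, 'a) free_alg. x - y \<in> free_product_ideal)"
  proof (rule transpI)
    fix x y z :: "('i, 'a) free_alg"
    assume "x - y \<in> free_product_ideal" "y - z \<in> free_product_ideal"
    then have "(x - y) + (y - z) \<in> free_product_ideal" by (rule free_product_ideal.add)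
    then show "x - z \<in> free_product_ideal" by simp
  qed
qed

lemma free_alg_induct [case_names single add]:
  fixes x :: "'b list \<Rightarrow>\<^sub>0 complex"
  assumes "\<And>w c. P (Poly_Mapping.single w c)" and "\<And>x y. P x \<Longrightarrow> P y \<Longrightarrow> P (x + y)"
  shows "P x"
proof (induction x rule: update_induct)
  case const
  show ?case using assms(1)[of "[]" 0] by simp
next
  case (update f a b)
  have "Poly_Mapping.update a b f = Poly_Mapping.single a b + f"
    using update(1) by (intro poly_mapping_eqI)
      (auto simp: lookup_update lookup_add lookup_single when_def in_keys_iff)
  then show ?case using assms update by simp
qed

lemma scalar_central: "scalar c * x = x * scalar c"
proof (induction x rule: free_alg_induct)
  case (single w d)
  then show ?case by (simp add: scalar_def mult_single plus_list_def mult.commute)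
qed (simp add: algebra_simps)

lemma scalar_add: "scalar (c + d) = scalar c + scalar d"
  by (simp add: scalar_def single_add)

lemma scalar_mult: "scalar (c * d) = scalar c * scalar d"
  by (simp add: scalar_def mult_single plus_list_def)

lemma scalar_one: "scalar 1 = 1"
  by (simp add: scalar_def flip: zero_list_def)

text \<open>Evaluating every letter \<open>(i, a)\<close> at \<open>a\<close> shows that the quotient is not the zero algebra.\<close>

definition fold_eval :: "('i, 'a::complex_algebra_1) free_alg \<Rightarrow> 'a" where
  "fold_eval x = (\<Sum>w\<in>Poly_Mapping.keys x. Poly_Mapping.lookup x w *\<^sub>C prod_list (map snd w))"

lemma scaleC_zero_left: "0 *\<^sub>C x = (0 :: 'a::complex_algebra_1)"
  using scaleC_add_left[of 0 0 x] by simp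

lemma fold_eval_superset:
  assumes "finite A" "Poly_Mapping.keys x \<subseteq> A"
  shows "fold_eval x = (\<Sum>w\<in>A. Poly_Mapping.lookup x w *\<^sub>C prod_list (map snd w))"
  unfolding fold_eval_def using assms
  by (intro sum.mono_neutral_left) (auto simp: in_keys_iff scaleC_zero_left)

lemma fold_eval_add: "fold_eval (x + y) = fold_eval x + fold_eval y"
proof -
  let ?A = "Poly_Mapping.keys x \<union> Poly_Mapping.keys y"
  have "finite ?A" "Poly_Mapping.keys (x + y) \<subseteq> ?A"
    using keys_add[of x y] by auto
  then show ?thesis
    by (simp add: fold_eval_superset[of ?A] lookup_add scaleC_add_left sum.distrib)
qed

lemma fold_eval_single: "fold_eval (Poly_Mapping.single w c) = c *\<^sub>C prod_list (map snd w)"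
  by (subst fold_eval_superset[of "{w}"]) auto

lemma fold_eval_diff: "fold_eval (x - y) = fold_eval x - fold_eval y"
  using fold_eval_add[of "x - y" y] by simp

lemma fold_eval_mult: "fold_eval (x * y) = fold_eval x * fold_eval y"
proof (induction x rule: free_alg_induct)
  case (single w c)
  show ?case
  proof (induction y rule: free_alg_induct)
    case (single v d)
    then show ?case
      by (simp add: mult_single fold_eval_single plus_list_def mult_scaleC_left mult_scaleC_right
          scaleC_scaleC mult.commute[of d c])
  qed (simp add: distrib_left fold_eval_add)
qed (simp add: distrib_right fold_eval_add)

lemma fold_eval_one: "fold_eval 1 = 1"
  unfolding scalar_one[symmetric] scalar_def by (simp add: fold_eval_single scaleC_one)

lemma fold_eval_ideal: "x \<in> free_product_ideal \<Longrightarrow> fold_eval x = 0"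
  by (induction rule: free_product_ideal.induct)
    (simp_all add: fold_eval_diff fold_eval_add fold_eval_mult fold_eval_one letter_def scalar_def
      fold_eval_single scaleC_one mult_scaleC_left)

instantiation free_product :: (type, complex_algebra_1) complex_algebra_1
begin

lift_definition zero_free_product :: "('a, 'b) free_product" is 0 .

lift_definition one_free_product :: "('a, 'b) free_product" is 1 .

lift_definition plus_free_product ::
  "('a, 'b) free_product \<Rightarrow> ('a, 'b) free_product \<Rightarrow> ('a, 'b) free_product" is "(+)"
proof -
  fix x x' y y' :: "('a, 'b) free_alg"
  assume "x - x' \<in> free_product_ideal" "y - y' \<in> free_product_ideal"
  then have "(x - x') + (y - y') \<in> free_product_ideal" by (rule free_product_ideal.add)
  then show "x + y - (x' + y') \<in> free_product_ideal" by (simp add: algebra_simps)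
qed

lift_definition minus_free_product ::
  "('a, 'b) free_product \<Rightarrow> ('a, 'b) free_product \<Rightarrow> ('a, 'b) free_product" is "(-)"
proof -
  fix x x' y y' :: "('a, 'b) free_alg"
  assume "x - x' \<in> free_product_ideal" "y - y' \<in> free_product_ideal"
  then have "(x - x') - (y - y') \<in> free_product_ideal" by (rule free_product_ideal_minus)
  then show "x - y - (x' - y') \<in> free_product_ideal" by (simp add: algebra_simps)
qed

lift_definition uminus_free_product :: "('a, 'b) free_product \<Rightarrow> ('a, 'b) free_product" is "uminus"
proof -
  fix x x' :: "('a, 'b) free_alg"
  assume "x - x' \<in> free_product_ideal"
  then have "- (x - x') \<in> free_product_ideal" by (rule free_product_ideal_uminus)
  then show "- x - - x' \<in> free_product_ideal" by simp
qed

lift_definition times_free_product ::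
  "('a, 'b) free_product \<Rightarrow> ('a, 'b) free_product \<Rightarrow> ('a, 'b) free_product" is "(*)"
proof -
  fix x x' y y' :: "('a, 'b) free_alg"
  assume "x - x' \<in> free_product_ideal" "y - y' \<in> free_product_ideal"
  then have "(x - x') * y + x' * (y - y') \<in> free_product_ideal"
    by (intro free_product_ideal.add free_product_ideal_mult_left free_product_ideal_mult_right)
  then show "x * y - x' * y' \<in> free_product_ideal" by (simp add: algebra_simps)
qed

lift_definition scaleC_free_product ::
  "complex \<Rightarrow> ('a, 'b) free_product \<Rightarrow> ('a, 'b) free_product" is "\<lambda>c x. scalar c * x"
  by (simp add: free_product_ideal_mult_left flip: right_diff_distrib)

instance
proof
  show "(0 :: ('a, 'b) free_product) \<noteq> 1"
  proof (transfer, rule notI)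
    assume "0 - 1 \<in> (free_product_ideal :: ('a, 'b) free_alg set)"
    then have "fold_eval (0 - 1 :: ('a, 'b) free_alg) = 0" by (rule fold_eval_ideal)
    then show False unfolding fold_eval_diff fold_eval_one by (simp add: fold_eval_def)
  qed
next
  fix c d :: complex and x y :: "('a, 'b) free_product"
  show "c *\<^sub>C (x + y) = c *\<^sub>C x + c *\<^sub>C y"
    by transfer (simp add: distrib_left free_product_ideal_0)
  show "(c + d) *\<^sub>C x = c *\<^sub>C x + d *\<^sub>C x"
    by transfer (simp add: distrib_right scalar_add free_product_ideal_0)
  show "c *\<^sub>C d *\<^sub>C x = (c * d) *\<^sub>C x"
    by transfer (simp add: scalar_mult mult.assoc free_product_ideal_0)
  show "1 *\<^sub>C x = x"
    by transfer (simp add: scalar_one free_product_ideal_0)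
  show "(c *\<^sub>C x) * y = c *\<^sub>C (x * y)"
    by transfer (simp add: mult.assoc free_product_ideal_0)
  show "x * (c *\<^sub>C y) = c *\<^sub>C (x * y)"
  proof transfer
    fix c and x y :: "('a, 'b) free_alg"
    have "x * (scalar c * y) = scalar c * (x * y)"
      by (metis mult.assoc scalar_central)
    then show "x * (scalar c * y) - scalar c * (x * y) \<in> free_product_ideal"
      by (simp add: free_product_ideal_0)
  qed
next
  fix x y z :: "('a, 'b) free_product"
  show "x + y + z = x + (y + z)" by transfer (simp add: add.assoc free_product_ideal_0)
  show "x + y = y + x" by transfer (simp add: add.commute free_product_ideal_0)
  show "0 + x = x" by transfer (simp add: free_product_ideal_0)
  show "- x + x = 0" by transfer (simp add: free_product_ideal_0)
  show "x - y = x + - y" by transfer (simp add: free_product_ideal_0)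
  show "x * y * z = x * (y * z)" by transfer (simp add: mult.assoc free_product_ideal_0)
  show "(x + y) * z = x * z + y * z" by transfer (simp add: distrib_right free_product_ideal_0)
  show "x * (y + z) = x * y + x * z" by transfer (simp add: distrib_left free_product_ideal_0)
  show "1 * x = x" by transfer (simp add: free_product_ideal_0)
  show "x * 1 = x" by transfer (simp add: free_product_ideal_0)
qed

end

lift_definition embed :: "'i \<Rightarrow> 'a::complex_algebra_1 \<Rightarrow> ('i, 'a) free_product" is letter .


section \<open>The \<open>\<alpha>\<close>-free product\<close>

text \<open>Positions in a list are counted from \<open>0\<close>.\<close>

definition peaks :: "'i::linorder list \<Rightarrow> nat set" where
  "peaks idx = {k. 0 < k \<and> Suc k < length idx \<and>
     idx ! (k - 1) < idx ! k \<and> idx ! k > idx ! Suc k}"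

definition bottoms :: "'i::linorder list \<Rightarrow> nat set" where
  "bottoms idx = {k. 0 < k \<and> Suc k < length idx \<and>
     idx ! (k - 1) > idx ! k \<and> idx ! k < idx ! Suc k}"

text \<open>The functional at position \<open>k\<close>, where \<open>\<chi>\<close> is the family used at the first position:
  \<open>\<chi> = \<phi>\<close>, \<open>\<psi>\<close>, \<open>\<theta>\<close> yields \<open>\<alpha>\<close>, \<open>\<beta>\<close>, \<open>\<gamma>\<close> respectively.\<close>

definition position_functional ::
  "('i::linorder \<Rightarrow> 'a \<Rightarrow> complex) \<Rightarrow> ('i \<Rightarrow> 'a \<Rightarrow> complex) \<Rightarrow> ('i \<Rightarrow> 'a \<Rightarrow> complex) \<Rightarrow>
     'i list \<Rightarrow> nat \<Rightarrow> 'a \<Rightarrow> complex" where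
  "position_functional \<chi> \<psi> \<theta> idx k =
     (if k = 0 then \<chi> (idx ! 0)
      else if k \<in> peaks idx then \<psi> (idx ! k)
      else if k \<in> bottoms idx then \<theta> (idx ! k)
      else (\<lambda>_. 0))"

definition vanishes_on_kernels ::
  "('i::linorder \<Rightarrow> 'a::complex_algebra_1 \<Rightarrow> complex) \<Rightarrow> ('i \<Rightarrow> 'a \<Rightarrow> complex) \<Rightarrow>
     ('i \<Rightarrow> 'a \<Rightarrow> complex) \<Rightarrow> (('i, 'a) free_product \<Rightarrow> complex) \<Rightarrow> bool" where
  "vanishes_on_kernels \<chi> \<psi> \<theta> F \<longleftrightarrow>
     (\<forall>idx as. idx \<noteq> [] \<and> distinct_adj idx \<and> length as = length idx \<and>
        (\<forall>k < length idx. position_functional \<chi> \<psi> \<theta> idx k (as ! k) = 0) \<longrightarrow>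
        F (prod_list (map2 embed idx as)) = 0)"

definition is_alpha_free_product ::
  "('i::linorder \<Rightarrow> 'a::complex_algebra_1 \<Rightarrow> complex) \<Rightarrow> ('i \<Rightarrow> 'a \<Rightarrow> complex) \<Rightarrow>
     ('i \<Rightarrow> 'a \<Rightarrow> complex) \<Rightarrow>
     (('i, 'a) free_product \<Rightarrow> complex) \<times> (('i, 'a) free_product \<Rightarrow> complex) \<times>
     (('i, 'a) free_product \<Rightarrow> complex) \<Rightarrow> bool" where
  "is_alpha_free_product \<phi> \<psi> \<theta> = (\<lambda>(\<Phi>, \<Psi>, \<Theta>).
     unital_functional \<Phi> \<and> unital_functional \<Psi> \<and> unital_functional \<Theta> \<and>
     vanishes_on_kernels \<phi> \<psi> \<theta> \<Phi> \<and>
     vanishes_on_kernels \<psi> \<psi> \<theta> \<Psi> \<and>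
     vanishes_on_kernels \<theta> \<psi> \<theta> \<Theta>)"

definition alpha_free_product ::
  "('i::linorder \<Rightarrow> 'a::complex_algebra_1 \<Rightarrow> complex) \<Rightarrow> ('i \<Rightarrow> 'a \<Rightarrow> complex) \<Rightarrow>
     ('i \<Rightarrow> 'a \<Rightarrow> complex) \<Rightarrow>
     (('i, 'a) free_product \<Rightarrow> complex) \<times> (('i, 'a) free_product \<Rightarrow> complex) \<times>
     (('i, 'a) free_product \<Rightarrow> complex)" where
  "alpha_free_product \<phi> \<psi> \<theta> = (THE T. is_alpha_free_product \<phi> \<psi> \<theta> T)"


section \<open>Cumulants\<close>

text \<open>\<open>N.a\<close>. The copies are numbered \<open>0, 1, 2, \<dots>\<close> instead of \<open>1, 2, 3, \<dots>\<close>, so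
  \<open>a\<^sup>(\<^sup>1\<^sup>) + \<dots> + a\<^sup>(\<^sup>N\<^sup>)\<close> becomes a sum over \<open>j < N\<close>.\<close>

definition dot :: "nat \<Rightarrow> 'a::complex_algebra_1 \<Rightarrow> (nat, 'a) free_product" where
  "dot N a = (\<Sum>j<N. embed j a)"

text \<open>The coefficient of \<open>N\<close> in the polynomial that agrees with \<open>f\<close> on all natural numbers.\<close>

definition linear_coeff :: "(nat \<Rightarrow> complex) \<Rightarrow> complex" where
  "linear_coeff f = coeff (THE p. \<forall>N. poly p (of_nat N) = f N) 1"

definition alpha_cumulant ::
  "('a::complex_algebra_1 \<Rightarrow> complex) \<Rightarrow> ('a \<Rightarrow> complex) \<Rightarrow> ('a \<Rightarrow> complex) \<Rightarrow>
     'a list \<Rightarrow> complex" where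
  "alpha_cumulant \<phi> \<psi> \<theta> as =
     (let (\<Phi>, \<Psi>, \<Theta>) = alpha_free_product (\<lambda>_. \<phi>) (\<lambda>_. \<psi>) (\<lambda>_. \<theta>)
      in linear_coeff (\<lambda>N. \<Phi> (prod_list (map (dot N) as))))"

definition beta_cumulant ::
  "('a::complex_algebra_1 \<Rightarrow> complex) \<Rightarrow> ('a \<Rightarrow> complex) \<Rightarrow> ('a \<Rightarrow> complex) \<Rightarrow>
     'a list \<Rightarrow> complex" where
  "beta_cumulant \<phi> \<psi> \<theta> as =
     (let (\<Phi>, \<Psi>, \<Theta>) = alpha_free_product (\<lambda>_. \<phi>) (\<lambda>_. \<psi>) (\<lambda>_. \<theta>)
      in linear_coeff (\<lambda>N. \<Psi> (prod_list (map (dot N) as))))"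

definition gamma_cumulant ::
  "('a::complex_algebra_1 \<Rightarrow> complex) \<Rightarrow> ('a \<Rightarrow> complex) \<Rightarrow> ('a \<Rightarrow> complex) \<Rightarrow>
     'a list \<Rightarrow> complex" where
  "gamma_cumulant \<phi> \<psi> \<theta> as =
     (let (\<Phi>, \<Psi>, \<Theta>) = alpha_free_product (\<lambda>_. \<phi>) (\<lambda>_. \<psi>) (\<lambda>_. \<theta>)
      in linear_coeff (\<lambda>N. \<Theta> (prod_list (map (dot N) as))))"


section \<open>Ordered noncrossing partitions\<close>

definition noncrossing :: "nat set set \<Rightarrow> bool" where
  "noncrossing S \<longleftrightarrow>
     \<not> (\<exists>B\<in>S. \<exists>B'\<in>S. B \<noteq> B' \<and>
          (\<exists>i\<in>B. \<exists>j\<in>B. \<exists>k\<in>B'. \<exists>l\<in>B'. i < k \<and> k < j \<and> j < l))"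

definition ONC :: "nat \<Rightarrow> nat set list set" where
  "ONC n = {\<pi>. distinct \<pi> \<and> partition_on {1..n} (set \<pi>) \<and> noncrossing (set \<pi>)}"

definition precedes :: "nat set list \<Rightarrow> nat set \<Rightarrow> nat set \<Rightarrow> bool" where
  "precedes \<pi> P Q \<longleftrightarrow> (\<exists>i j. i < j \<and> j < length \<pi> \<and> \<pi> ! i = P \<and> \<pi> ! j = Q)"

definition covers :: "nat set \<Rightarrow> nat set \<Rightarrow> bool" where
  "covers P' P \<longleftrightarrow> (\<exists>i\<in>P'. \<exists>j\<in>P'. \<forall>k\<in>P. i < k \<and> k < j)"

definition inner_blocks :: "nat set list \<Rightarrow> nat set set" where
  "inner_blocks \<pi> = {P \<in> set \<pi>. \<exists>P'\<in>set \<pi>. covers P' P}"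

definition outer_blocks :: "nat set list \<Rightarrow> nat set set" where
  "outer_blocks \<pi> = set \<pi> - inner_blocks \<pi>"

definition nearest_cover :: "nat set list \<Rightarrow> nat set \<Rightarrow> nat set" where
  "nearest_cover \<pi> P =
     (THE Q. Q \<in> set \<pi> \<and> covers Q P \<and> \<not> (\<exists>P'\<in>set \<pi>. covers P' P \<and> covers Q P'))"

definition B_blocks :: "nat set list \<Rightarrow> nat set set" where
  "B_blocks \<pi> = {P \<in> inner_blocks \<pi>. precedes \<pi> (nearest_cover \<pi> P) P}"

definition C_blocks :: "nat set list \<Rightarrow> nat set set" where
  "C_blocks \<pi> = {P \<in> inner_blocks \<pi>. precedes \<pi> P (nearest_cover \<pi> P)}"

text \<open>The tuple \<open>a\<^sub>P\<close>, in increasing order of the indices.\<close>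

definition restrict_tuple :: "(nat \<Rightarrow> 'a) \<Rightarrow> nat set \<Rightarrow> 'a list" where
  "restrict_tuple a P = map a (sorted_list_of_set P)"

end

theory Submission
  imports Defs
begin

text \<open>The \<open>\<alpha>\<close>-free product is computed by a stack machine that reads a word from left to right:
  a letter is multiplied onto the top of the stack if the labels agree and pushed otherwise, and
  the new top \<open>b\<close> is split as \<open>f(b) 1 + (b - f(b) 1)\<close>, where \<open>f\<close> is \<open>\<psi>\<close> or \<open>\<theta>\<close> according to
  whether the label below is smaller or larger, and \<open>\<chi>\<close> at the bottom of the stack; the value of a
  word is the total weight of the runs that end with the empty stack. This defines the product,
  and the same recursion shows its uniqueness.

  Let \<open>p\<close> be the polynomial \<open>N \<mapsto> \<Phi>((N.a\<^sub>1)\<cdots>(N.a\<^sub>n))\<close>. Splitting \<open>N M\<close> copies into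
  \<open>N\<close> groups of \<open>M\<close> consecutive ones expresses \<open>p(N M)\<close> as \<open>\<Sum>\<^sub>k (N choose k) R\<^sub>k(M)\<close>, where
  \<open>R\<^sub>k(M)\<close> sums the values of the words whose letters are distributed over exactly \<open>k\<close>
  groups. The groups obey the same stack recursion, with moments of the form \<open>M K + O(M\<^sup>2)\<close>, so
  \<open>R\<^sub>k(M) = M\<^sup>k (c\<^sub>k + O(M))\<close>, and \<open>M = 1/N\<close>, \<open>N \<rightarrow> \<infinity>\<close> gives
  \<open>p(1) = \<Sum>\<^sub>k c\<^sub>k / k!\<close>. To leading order every group is evaluated only once, when its last letter
  has been read; this is impossible for a crossing word, and in a noncrossing word the label below
  on the stack is then that of the nearest cover.\<close>

section \<open>Unital functionals\<close>

lemma unital_functional_iff: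
  "unital_functional f \<longleftrightarrow>
     (\<forall>x y. f (x + y) = f x + f y) \<and> (\<forall>c x. f (c *\<^sub>C x) = c * f x) \<and> f 1 = 1"
proof -
  have "vector_space ((*\<^sub>C) :: complex \<Rightarrow> 'a \<Rightarrow> 'a)"
    by unfold_locales (simp_all add: scaleC_add_right scaleC_add_left scaleC_scaleC scaleC_one)
  moreover have "vector_space ((*) :: complex \<Rightarrow> complex \<Rightarrow> complex)"
    by unfold_locales (simp_all add: algebra_simps)
  ultimately show ?thesis
    by (auto simp: unital_functional_def Vector_Spaces.linear_iff)
qed

context
  fixes f :: "'a::complex_algebra_1 \<Rightarrow> complex"
  assumes f: "unital_functional f"
begin

lemma unital_add: "f (x + y) = f x + f y"
  and unital_scale: "f (c *\<^sub>C x) = c * f x"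
  and unital_one: "f 1 = 1"
  using f by (auto simp: unital_functional_iff)

lemma unital_diff: "f (x - y) = f x - f y"
  using unital_add[of "x - y" y] by simp

lemma unital_zero: "f 0 = 0"
  using unital_add[of 0 0] by simp

lemma unital_sum: "f (\<Sum>i\<in>I. g i) = (\<Sum>i\<in>I. f (g i))"
  by (induction I rule: infinite_finite_induct) (simp_all add: unital_zero unital_add)

lemmas unital_simps = unital_add unital_scale unital_one unital_diff unital_zero unital_sum

end

lemma scaleC_diff_right: "c *\<^sub>C (x - y) = c *\<^sub>C x - c *\<^sub>C (y :: 'a::complex_algebra_1)"
  using scaleC_add_right[of c "x - y" y] by (simp add: algebra_simps)

lemma scaleC_diff_left: "(c - d) *\<^sub>C x = c *\<^sub>C x - d *\<^sub>C (x :: 'a::complex_algebra_1)"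
  using scaleC_add_left[of "c - d" d x] by (simp add: algebra_simps)

lemmas scaleC_simps = scaleC_add_right scaleC_add_left scaleC_diff_right scaleC_diff_left
  scaleC_scaleC scaleC_one scaleC_zero_left mult_scaleC_left mult_scaleC_right

section \<open>The stack machine\<close>

text \<open>The payload type \<open>'b\<close> stays arbitrary because the same choice is made later
  on stacks of words. On centred stacks the label below differs from \<open>i\<close>, so
  \<open>z\<close> is then the case of a larger label.\<close>

definition pick :: "'f \<Rightarrow> 'f \<Rightarrow> 'f \<Rightarrow> ('i::linorder \<times> 'b) list \<Rightarrow> 'i \<Rightarrow> 'f" where
  "pick x y z s i = (case s of [] \<Rightarrow> x | (j, _) # _ \<Rightarrow> if j < i then y else z)"

lemma pick_simps [simp]:
  "pick x y z [] i = x"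
  "pick x y z ((j, b) # s) i = (if j < i then y else z)"
  by (simp_all add: pick_def)

definition fresh :: "'i \<Rightarrow> ('i \<times> 'b) list \<Rightarrow> bool" where
  "fresh i s \<longleftrightarrow> s = [] \<or> fst (hd s) \<noteq> i"

lemma fresh_simps [simp]: "fresh i []" "fresh i ((j, b) # s) \<longleftrightarrow> j \<noteq> i"
  by (simp_all add: fresh_def)

lemma top_cases:
  obtains (top) b s' where "s = (i, b) # s'" | (fresh) "fresh i s"
  by (metis fresh_def list.exhaust_sel prod.collapse)

definition null_stack :: "'s list \<Rightarrow> complex" where
  "null_stack s = (if s = [] then 1 else 0)"

lemma null_stack_simps [simp]: "null_stack [] = 1" "null_stack (x # s) = 0"
  by (simp_all add: null_stack_def)

locale functional_pair =
  fixes \<psi> \<theta> :: "'a::complex_algebra_1 \<Rightarrow> complex"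
  assumes unital_\<psi>: "unital_functional \<psi>" and unital_\<theta>: "unital_functional \<theta>"
begin

text \<open>The machine acts backwards on functionals of stacks: \<open>h\<close> is the value of
  what follows, and the two summands are the two runs after the split of the new top. The sum over
  all runs of a word thus never has to be written down.\<close>

definition push ::
  "('a \<Rightarrow> complex) \<Rightarrow> 'i::linorder \<times> 'a \<Rightarrow> (('i \<times> 'a) list \<Rightarrow> complex) \<Rightarrow> ('i \<times> 'a) list \<Rightarrow> complex"
  where
  "push \<chi> = (\<lambda>(i, a) h s.
     (case (case s of [] \<Rightarrow> (a, s) | (j, b) # s' \<Rightarrow> if j = i then (b * a, s') else (a, s)) of
        (x, s') \<Rightarrow> h ((i, x - pick \<chi> \<psi> \<theta> s' i x *\<^sub>C 1) # s') + pick \<chi> \<psi> \<theta> s' i x * h s'))"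

lemma push_top:
  "push \<chi> (i, a) h ((i, b) # s) =
     h ((i, b * a - pick \<chi> \<psi> \<theta> s i (b * a) *\<^sub>C 1) # s) + pick \<chi> \<psi> \<theta> s i (b * a) * h s"
  by (simp add: push_def)

lemma push_fresh:
  "fresh i s \<Longrightarrow> push \<chi> (i, a) h s =
     h ((i, a - pick \<chi> \<psi> \<theta> s i a *\<^sub>C 1) # s) + pick \<chi> \<psi> \<theta> s i a * h s"
  by (cases s) (auto simp: push_def)

primrec run ::
  "('a \<Rightarrow> complex) \<Rightarrow> ('i::linorder \<times> 'a) list \<Rightarrow> (('i \<times> 'a) list \<Rightarrow> complex) \<Rightarrow>
     ('i \<times> 'a) list \<Rightarrow> complex" where
  "run \<chi> [] g = g"
| "run \<chi> (x # w) g = push \<chi> x (run \<chi> w g)"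

lemma run_append: "run \<chi> (v @ w) g = run \<chi> v (run \<chi> w g)"
  by (induction v) simp_all

lemma push_linear:
  "push \<chi> x (\<lambda>s. c * g s + d * h s) = (\<lambda>s. c * push \<chi> x g s + d * push \<chi> x h s)"
proof
  fix s
  obtain i a where x: "x = (i, a)" by force
  show "push \<chi> x (\<lambda>s. c * g s + d * h s) s = c * push \<chi> x g s + d * push \<chi> x h s"
    by (cases rule: top_cases[of s i]) (simp_all add: x push_top push_fresh algebra_simps)
qed

lemma run_linear:
  "run \<chi> w (\<lambda>s. c * g s + d * h s) = (\<lambda>s. c * run \<chi> w g s + d * run \<chi> w h s)"
  by (induction w) (simp_all add: push_linear)

subsection \<open>Centred stacks\<close>

text \<open>The invariant of the stacks reached from the empty one. On such stacks reading a unit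
  has no effect and a product may be read factor by factor (\<open>push_one\<close>,
  \<open>push_mult\<close>).\<close>

fun centred :: "('a \<Rightarrow> complex) \<Rightarrow> ('i::linorder \<times> 'a) list \<Rightarrow> bool" where
  "centred \<chi> [] \<longleftrightarrow> True"
| "centred \<chi> ((i, b) # s) \<longleftrightarrow> pick \<chi> \<psi> \<theta> s i b = 0 \<and> fresh i s \<and> centred \<chi> s"

definition stack_linear :: "(('i \<times> 'a) list \<Rightarrow> complex) \<Rightarrow> bool" where
  "stack_linear g \<longleftrightarrow>
     (\<forall>t i s b c. g (t @ (i, b + c) # s) = g (t @ (i, b) # s) + g (t @ (i, c) # s)) \<and>
     (\<forall>t i s b k. g (t @ (i, k *\<^sub>C b) # s) = k * g (t @ (i, b) # s))"

lemma stack_linear_null: "stack_linear null_stack"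
  by (simp add: stack_linear_def null_stack_def)

context
  fixes \<chi> :: "'a \<Rightarrow> complex"
  assumes unital_\<chi>: "unital_functional \<chi>"
begin

lemma unital_pick: "unital_functional (pick \<chi> \<psi> \<theta> s i)"
  by (cases s) (auto simp: unital_\<chi> unital_\<psi> unital_\<theta>)

lemmas pick_unital_simps = unital_simps[OF unital_pick]

text \<open>Both successors of a centred stack are centred: subtracting the scalar
  \<open>f(x)\<close> puts the new top into the kernel of the unital \<open>f\<close>, and removing
  the top leaves a centred stack.\<close>

lemma centred_push:
  assumes "\<And>s. centred \<chi> s \<Longrightarrow> g s = h s" "centred \<chi> s"
  shows "push \<chi> x g s = push \<chi> x h s"
proof -
  obtain i a where x: "x = (i, a)" by force
  show ?thesis
    using assms(2) by (cases rule: top_cases[of s i])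
      (simp_all add: x push_top push_fresh assms(1) pick_unital_simps)
qed

lemma centred_run:
  assumes "\<And>s. centred \<chi> s \<Longrightarrow> g s = h s" "centred \<chi> s"
  shows "run \<chi> w g s = run \<chi> w h s"
  using assms(2)
proof (induction w arbitrary: s)
  case (Cons x w)
  then show ?case by (auto intro: centred_push)
qed (simp add: assms)

lemma pick_append_Cons: "pick x y z (t @ (j, b) # s) i = pick x y z (t @ (j, c) # s) i"
  by (cases t) auto

lemma stack_linear_add:
  "stack_linear g \<Longrightarrow> g (t @ (i, b + c) # s) = g (t @ (i, b) # s) + g (t @ (i, c) # s)"
  and stack_linear_scale: "stack_linear g \<Longrightarrow> g (t @ (i, k *\<^sub>C b) # s) = k * g (t @ (i, b) # s)"
  by (simp_all add: stack_linear_def)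

lemma stack_linear_diff:
  assumes "stack_linear g"
  shows "g (t @ (i, b - c) # s) = g (t @ (i, b) # s) - g (t @ (i, c) # s)"
  using stack_linear_add[OF assms, of t i "b - c" c s] by simp

lemma stack_linear_zero:
  assumes "stack_linear g"
  shows "g (t @ (i, 0) # s) = 0"
  using stack_linear_add[OF assms, of t i 0 0 s] by simp

lemmas stack_linear_simps = stack_linear_add stack_linear_scale stack_linear_diff stack_linear_zero
lemmas stack_linear_hd = stack_linear_simps[where t = "[]", simplified]

lemma stack_linear_push:
  assumes g: "stack_linear g"
  shows "stack_linear (push \<chi> x g)"
proof -
  obtain i a where x: "x = (i, a)" by force
  \<comment> \<open>One identity for additivity and homogeneity together. The choice of functional
    depends on labels alone, so changing an entry leaves it fixed.\<close>
  have *: "push \<chi> x g (t @ (j, k *\<^sub>C b + c) # s) =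
      k * push \<chi> x g (t @ (j, b) # s) + push \<chi> x g (t @ (j, c) # s)" for t j b c k s
  proof (cases t)
    case Nil
    show ?thesis
    proof (cases "j = i")
      case True
      then show ?thesis
        by (simp add: x Nil push_top pick_unital_simps algebra_simps scaleC_simps
            stack_linear_hd[OF g])
    next
      case False
      then show ?thesis
        using stack_linear_simps[OF g, where t = "[u]" for u]
        by (simp add: x Nil push_fresh stack_linear_hd[OF g] algebra_simps)
    qed
  next
    case (Cons y t')
    obtain m d where y: "y = (m, d)" by force
    note g_simps = stack_linear_simps[OF g, where t = "u # t'" for u, simplified]
      stack_linear_simps[OF g, where t = "u # v # t'" for u v, simplified]
    define f where "f = pick \<chi> \<psi> \<theta> (t' @ (j, 0) # s) i"
    have p: "pick \<chi> \<psi> \<theta> (t' @ (j, e) # s) i = f" for e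
      unfolding f_def by (rule pick_append_Cons)
    show ?thesis
    proof (cases "m = i")
      case True
      then show ?thesis
        by (simp add: x y Cons push_top p g_simps stack_linear_simps[OF g] algebra_simps)
    next
      case False
      then show ?thesis
        by (simp add: x y Cons push_fresh g_simps algebra_simps)
    qed
  qed
  have z: "push \<chi> x g (t @ (j, 0) # s) = 0" for t j s
    using *[of t j 1 0 0 s] by (simp add: scaleC_one)
  show ?thesis
    unfolding stack_linear_def
    using *[of _ _ 1] *[of _ _ _ _ 0] z by (simp add: scaleC_one)
qed

lemma stack_linear_run: "stack_linear g \<Longrightarrow> stack_linear (run \<chi> w g)"
  by (induction w) (simp_all add: stack_linear_push)

lemma push_add:
  assumes "stack_linear g"
  shows "push \<chi> (i, a + b) g s = push \<chi> (i, a) g s + push \<chi> (i, b) g s"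
  by (cases rule: top_cases[of s i])
    (simp_all add: push_top push_fresh stack_linear_hd[OF assms] pick_unital_simps algebra_simps)

lemma push_scale:
  assumes "stack_linear g"
  shows "push \<chi> (i, c *\<^sub>C a) g s = c * push \<chi> (i, a) g s"
  by (cases rule: top_cases[of s i])
    (simp_all add: push_top push_fresh stack_linear_hd[OF assms] pick_unital_simps
      algebra_simps mult_scaleC_right)

text \<open>On a fresh label the pushed entry is \<open>1 - 1 = 0\<close>, which multilinearity
  kills, and the evaluated branch has weight \<open>1\<close>. On the top label the entry is already
  centred, so the evaluated branch has weight \<open>0\<close>.\<close>

lemma push_one:
  assumes "stack_linear g" "centred \<chi> s"
  shows "push \<chi> (i, 1) g s = g s"
  using assms(2) by (cases rule: top_cases[of s i])
    (simp_all add: push_top push_fresh stack_linear_hd[OF assms(1)] pick_unital_simps scaleC_simps)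

text \<open>Reading \<open>a\<close> and then \<open>b\<close> on a fresh label produces the terms
  of \<open>(a - f(a) 1) b\<close> and of \<open>f(a) b\<close> over the same stack; by
  multilinearity they add up to those of \<open>a b\<close>. On the top label the old entry is an
  extra left factor.\<close>

lemma push_mult:
  assumes "stack_linear g" "centred \<chi> s"
  shows "push \<chi> (i, a * b) g s = push \<chi> (i, a) (push \<chi> (i, b) g) s"
  using assms(2) by (cases rule: top_cases[of s i])
    (simp_all add: push_top push_fresh stack_linear_hd[OF assms(1)] pick_unital_simps
      algebra_simps scaleC_simps)

end

subsection \<open>Extension to the free algebra\<close>

definition lin_run ::
  "('a \<Rightarrow> complex) \<Rightarrow> ('i::linorder, 'a) free_alg \<Rightarrow> (('i \<times> 'a) list \<Rightarrow> complex) \<Rightarrow>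
     ('i \<times> 'a) list \<Rightarrow> complex" where
  "lin_run \<chi> x g s =
     (\<Sum>w\<in>Poly_Mapping.keys x. Poly_Mapping.lookup x w * run \<chi> w g s)"

lemma lin_run_superset:
  assumes "finite A" "Poly_Mapping.keys x \<subseteq> A"
  shows "lin_run \<chi> x g s = (\<Sum>w\<in>A. Poly_Mapping.lookup x w * run \<chi> w g s)"
  unfolding lin_run_def using assms
  by (intro sum.mono_neutral_left) (auto simp: in_keys_iff)

lemma lin_run_add: "lin_run \<chi> (x + y) g s = lin_run \<chi> x g s + lin_run \<chi> y g s"
proof -
  let ?A = "Poly_Mapping.keys x \<union> Poly_Mapping.keys y"
  have "finite ?A" "Poly_Mapping.keys (x + y) \<subseteq> ?A"
    using keys_add[of x y] by auto
  then show ?thesis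
    by (simp add: lin_run_superset[of ?A] lookup_add distrib_right sum.distrib)
qed

lemma lin_run_single: "lin_run \<chi> (Poly_Mapping.single w c) g s = c * run \<chi> w g s"
  by (subst lin_run_superset[of "{w}"]) auto

lemma lin_run_zero: "lin_run \<chi> 0 g s = 0"
  by (simp add: lin_run_def)

lemma lin_run_diff: "lin_run \<chi> (x - y) g s = lin_run \<chi> x g s - lin_run \<chi> y g s"
  using lin_run_add[of \<chi> "x - y" y] by simp

lemma lin_run_sum: "lin_run \<chi> (\<Sum>i\<in>I. x i) g s = (\<Sum>i\<in>I. lin_run \<chi> (x i) g s)"
  by (induction I rule: infinite_finite_induct) (simp_all add: lin_run_zero lin_run_add)

lemma lin_run_mult: "lin_run \<chi> (x * y) g s = lin_run \<chi> x (lin_run \<chi> y g) s"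
proof (induction x rule: free_alg_induct)
  case (single w c)
  show ?case
  proof (induction y rule: free_alg_induct)
    case (single v d)
    have "lin_run \<chi> (Poly_Mapping.single v d) g = (\<lambda>s. d * run \<chi> v g s + 0 * run \<chi> v g s)"
      by (simp add: lin_run_single fun_eq_iff)
    then show ?case
      by (simp only: run_linear lin_run_single mult_single) (simp add: plus_list_def run_append
          lin_run_single)
  next
    case (add x y)
    have "lin_run \<chi> (x + y) g = (\<lambda>s. 1 * lin_run \<chi> x g s + 1 * lin_run \<chi> y g s)"
      by (simp add: lin_run_add fun_eq_iff)
    then have "lin_run \<chi> (Poly_Mapping.single w c) (lin_run \<chi> (x + y) g) s =
        lin_run \<chi> (Poly_Mapping.single w c) (lin_run \<chi> x g) s +
        lin_run \<chi> (Poly_Mapping.single w c) (lin_run \<chi> y g) s"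
      by (simp only: run_linear lin_run_single) (simp add: algebra_simps)
    moreover have "lin_run \<chi> (Poly_Mapping.single w c * (x + y)) g s =
        lin_run \<chi> (Poly_Mapping.single w c * x) g s + lin_run \<chi> (Poly_Mapping.single w c * y) g s"
      by (simp add: distrib_left lin_run_add)
    ultimately show ?case using add by (simp only:)
  qed
qed (simp add: distrib_right lin_run_add)

lemma lin_run_mult_fun: "lin_run \<chi> (x * y) g = lin_run \<chi> x (lin_run \<chi> y g)"
  by (simp add: fun_eq_iff lin_run_mult)

lemma lin_run_letter: "lin_run \<chi> (letter i a) g s = push \<chi> (i, a) g s"
  by (simp add: letter_def lin_run_single)

lemma lin_run_scalar: "lin_run \<chi> (scalar c) g s = c * g s"
  by (simp add: scalar_def lin_run_single)

lemma lin_run_one: "lin_run \<chi> 1 g s = g s"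
  by (simp add: lin_run_scalar flip: scalar_one)

context
  fixes \<chi> :: "'a \<Rightarrow> complex"
  assumes unital_\<chi>: "unital_functional \<chi>"
begin

lemma stack_linear_lin_run:
  assumes "stack_linear g"
  shows "stack_linear (lin_run \<chi> x g)"
  using stack_linear_run[OF unital_\<chi> assms]
  by (simp add: stack_linear_def lin_run_def distrib_left sum.distrib sum_distrib_left
      mult.left_commute)

text \<open>Stated for every multilinear \<open>g\<close> and every centred stack so that it passes
  through \<open>u * x * v\<close>: the factor \<open>v\<close> turns \<open>g\<close> into another
  multilinear functional, and \<open>u\<close> leads from centred stacks only to centred
  ones.\<close>

lemma lin_run_ideal:
  assumes "x \<in> free_product_ideal" "stack_linear g" "centred \<chi> s"
  shows "lin_run \<chi> x g s = 0"
  using assms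
proof (induction arbitrary: g s rule: free_product_ideal.induct)
  case (mult x u v)
  have "lin_run \<chi> x (lin_run \<chi> v g) s = 0" if "centred \<chi> s" for s
    using mult.IH mult.prems(1) that by (blast intro: stack_linear_lin_run)
  then have "run \<chi> w (lin_run \<chi> x (lin_run \<chi> v g)) s = run \<chi> w (\<lambda>_. 0) s" for w
    using mult.prems(2) by (intro centred_run[OF unital_\<chi>]) auto
  moreover have "run \<chi> w (\<lambda>_. 0) s = 0" for w
    using run_linear[of \<chi> w 0 "\<lambda>_. 0" 0 "\<lambda>_. 0"] by simp
  ultimately have "lin_run \<chi> u (lin_run \<chi> x (lin_run \<chi> v g)) s = 0"
    by (simp add: lin_run_def)
  then show ?case
    by (simp add: lin_run_mult_fun mult.assoc)
next
  case (gen_add i a b)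
  then show ?case
    by (simp add: lin_run_diff lin_run_add lin_run_letter push_add[OF unital_\<chi>])
next
  case (gen_scale i c a)
  then show ?case
    by (simp add: lin_run_diff lin_run_mult lin_run_scalar lin_run_letter push_scale[OF unital_\<chi>])
next
  case (gen_mult i a b)
  have "lin_run \<chi> (letter i b) g = push \<chi> (i, b) g"
    by (simp add: lin_run_letter fun_eq_iff)
  with gen_mult show ?case
    by (simp add: lin_run_diff lin_run_mult lin_run_letter push_mult[OF unital_\<chi>])
next
  case (gen_one i)
  then show ?case
    by (simp add: lin_run_diff lin_run_one lin_run_letter push_one[OF unital_\<chi>])
next
  case (add x y)
  then show ?case by (simp add: lin_run_add)
qed

end

definition vacuum :: "('a \<Rightarrow> complex) \<Rightarrow> ('i::linorder, 'a) free_alg \<Rightarrow> complex" where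
  "vacuum \<chi> x = lin_run \<chi> x null_stack []"

lemma vacuum_add: "vacuum \<chi> (x + y) = vacuum \<chi> x + vacuum \<chi> y"
  and vacuum_diff: "vacuum \<chi> (x - y) = vacuum \<chi> x - vacuum \<chi> y"
  and vacuum_scalar: "vacuum \<chi> (scalar c) = c"
  and vacuum_scalar_mult: "vacuum \<chi> (scalar c * x) = c * vacuum \<chi> x"
  and vacuum_sum: "vacuum \<chi> (\<Sum>i\<in>I. h i) = (\<Sum>i\<in>I. vacuum \<chi> (h i))"
  and vacuum_one: "vacuum \<chi> 1 = 1"
  and vacuum_single: "vacuum \<chi> (Poly_Mapping.single w c) = c * run \<chi> w null_stack []"
  by (simp_all add: vacuum_def lin_run_add lin_run_diff lin_run_scalar lin_run_mult lin_run_sum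
      lin_run_one lin_run_single)

text \<open>\<open>rep_free_product\<close> picks some representative; by \<open>state_abs\<close>
  the choice is immaterial for unital \<open>\<chi>\<close>.\<close>

definition state :: "('a \<Rightarrow> complex) \<Rightarrow> ('i::linorder, 'a) free_product \<Rightarrow> complex" where
  "state \<chi> x = vacuum \<chi> (rep_free_product x)"

lemma state_abs:
  assumes "unital_functional \<chi>"
  shows "state \<chi> (abs_free_product x) = vacuum \<chi> x"
proof -
  have "rep_free_product (abs_free_product x) - x \<in> free_product_ideal"
    by (rule Quotient3_rep_abs[OF Quotient3_free_product]) (simp add: free_product_ideal_0)
  then have "vacuum \<chi> (rep_free_product (abs_free_product x) - x) = 0"
    unfolding vacuum_def by (intro lin_run_ideal[OF assms]) (auto simp: stack_linear_null)
  then show ?thesis by (simp add: state_def vacuum_diff)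
qed

lemma abs_rep: "abs_free_product (rep_free_product x) = x"
  by (rule Quotient3_abs_rep[OF Quotient3_free_product])

lemma unital_state:
  assumes "unital_functional \<chi>"
  shows "unital_functional (state \<chi> :: ('i::linorder, 'a) free_product \<Rightarrow> complex)"
proof -
  have "state \<chi> (x + y) = state \<chi> x + state \<chi> y" for x y :: "('i, 'a) free_product"
    using state_abs[OF assms, of "rep_free_product x + rep_free_product y"]
    by (simp add: plus_free_product.abs_eq[symmetric] abs_rep) (simp add: state_def vacuum_add)
  moreover have "state \<chi> (c *\<^sub>C x) = c * state \<chi> x" for c and x :: "('i, 'a) free_product"
    using state_abs[OF assms, of "scalar c * rep_free_product x"]
    by (simp add: scaleC_free_product.abs_eq[symmetric] abs_rep)
      (simp add: state_def vacuum_scalar_mult)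
  moreover have "state \<chi> (1 :: ('i, 'a) free_product) = 1"
    by (simp add: one_free_product.abs_eq state_abs[OF assms] vacuum_one)
  ultimately show ?thesis by (simp add: unital_functional_iff)
qed

lemma abs_free_product_word:
  "abs_free_product (Poly_Mapping.single w 1) = prod_list (map (\<lambda>(i, a). embed i a) w)"
proof (induction w)
  case Nil
  show ?case by (simp add: one_free_product.abs_eq flip: scalar_one scalar_def)
next
  case (Cons x w)
  obtain i a where x: "x = (i, a)" by force
  have "Poly_Mapping.single (x # w) 1 = letter i a * Poly_Mapping.single w (1::complex)"
    by (simp add: letter_def x mult_single plus_list_def)
  then show ?case
    using Cons by (simp add: embed.abs_eq x flip: times_free_product.abs_eq)
qed

lemma state_word:
  "unital_functional \<chi> \<Longrightarrow>
     state \<chi> (prod_list (map (\<lambda>(i, a). embed i a) w)) = run \<chi> w null_stack []"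
  by (simp add: abs_free_product_word[symmetric] state_abs vacuum_single)

subsection \<open>The machine computes the \<open>\<alpha>\<close>-free product\<close>

text \<open>The tail of a word after a letter with label \<open>j\<close>. Its last letter carries
  no kernel condition, because the functional at that position is \<open>0\<close>.\<close>

fun kernel_word :: "'i::linorder \<Rightarrow> ('i \<times> 'a) list \<Rightarrow> bool" where
  "kernel_word j [] \<longleftrightarrow> True"
| "kernel_word j [(i, a)] \<longleftrightarrow> i \<noteq> j"
| "kernel_word j ((i, a) # (i', a') # w) \<longleftrightarrow>
     i \<noteq> j \<and> (j < i \<and> i' < i \<longrightarrow> \<psi> a = 0) \<and> (i < j \<and> i < i' \<longrightarrow> \<theta> a = 0) \<and>
     kernel_word i ((i', a') # w)"

text \<open>The stack never empties. The label \<open>j'\<close> on top may be older than the label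
  \<open>j\<close> just read, but both lie on the same side of the next label \<open>i\<close>. At a
  peak or bottom the evaluation of \<open>i\<close> has weight \<open>0\<close>; otherwise
  \<open>j\<close>, \<open>i\<close> and the label after it are monotone, so after an evaluation
  \<open>j'\<close> and \<open>i\<close> again lie on the same side of that label.\<close>

lemma run_kernel_word:
  assumes "kernel_word j w" "s = (j', b) # s'"
    and "w \<noteq> [] \<Longrightarrow> j' \<noteq> fst (hd w) \<and> (j' < fst (hd w) \<longleftrightarrow> j < fst (hd w))"
  shows "run \<chi> w null_stack s = 0"
  using assms
proof (induction j w arbitrary: s j' b s' rule: kernel_word.induct)
  case (2 j i a)
  then show ?case by (simp add: push_fresh)
next
  case (3 j i a i' a' w)
  have keep: "run \<chi> ((i', a') # w) null_stack ((i, c) # s) = 0" for c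
    by (rule "3.IH"[of _ i c s]) (use 3(2) in \<open>cases w; auto\<close>)+
  have ne: "i' \<noteq> i" "i \<noteq> j" using 3(2) by (cases w; auto)+
  have drop: "run \<chi> ((i', a') # w) null_stack s = 0"
    if "\<not> (j < i \<and> i' < i)" "\<not> (i < j \<and> i < i')"
  proof (rule "3.IH"[of _ j' b s'])
    show "j' \<noteq> fst (hd ((i', a') # w)) \<and>
        (j' < fst (hd ((i', a') # w)) \<longleftrightarrow> i < fst (hd ((i', a') # w)))"
      using 3(4) that ne by auto
  qed (use 3(2-) in auto)
  have "pick \<chi> \<psi> \<theta> s i a = 0 \<or> run \<chi> ((i', a') # w) null_stack s = 0"
  proof (cases "(j < i \<and> i' < i) \<or> (i < j \<and> i < i')")
    case True
    then show ?thesis using 3(2-) by auto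
  qed (use drop in blast)
  then show ?case
    using 3(2-) keep by (auto simp: push_fresh)
qed simp

lemma position_functional_Cons:
  "position_functional \<chi> \<chi>' \<chi>'' (j # idx) (Suc (Suc k)) =
     position_functional \<chi>1 \<chi>' \<chi>'' idx (Suc k)"
proof -
  have "Suc (Suc k) \<in> peaks (j # idx) \<longleftrightarrow> Suc k \<in> peaks idx"
    "Suc (Suc k) \<in> bottoms (j # idx) \<longleftrightarrow> Suc k \<in> bottoms idx"
    by (auto simp: peaks_def bottoms_def)
  then show ?thesis by (simp only: position_functional_def) simp
qed

lemma kernel_word_positions:
  assumes "distinct_adj (j # idx)" "length as = length idx"
    and "\<And>k. k < length idx \<Longrightarrow>
      position_functional (\<lambda>_. \<chi>) (\<lambda>_. \<psi>) (\<lambda>_. \<theta>) (j # idx) (Suc k) (as ! k) = 0"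
  shows "kernel_word j (zip idx as)"
  using assms
proof (induction idx arbitrary: j as)
  case (Cons i idx)
  obtain a as' where as: "as = a # as'" using Cons.prems(2) by (cases as) auto
  show ?case
  proof (cases idx)
    case Nil
    then show ?thesis using Cons.prems as by (simp add: distinct_adj_Cons)
  next
    case idx: (Cons i' idx')
    obtain a' as'' where as': "as' = a' # as''" using Cons.prems(2) as idx by (cases as') auto
    have "kernel_word i (zip idx as')"
    proof (rule Cons.IH)
      fix k assume k: "k < length idx"
      show "position_functional (\<lambda>_. \<chi>) (\<lambda>_. \<psi>) (\<lambda>_. \<theta>) (i # idx) (Suc k) (as' ! k) = 0"
        using Cons.prems(3)[of "Suc k"] k
        by (simp add: as position_functional_Cons[of _ _ _ j "i # idx" _ "\<lambda>_. \<chi>"])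
    qed (use Cons.prems as in \<open>auto simp: distinct_adj_Cons\<close>)
    moreover have "position_functional (\<lambda>_. \<chi>) (\<lambda>_. \<psi>) (\<lambda>_. \<theta>) (j # i # idx) 1 a = 0"
      using Cons.prems(3)[of 0] as by simp
    then have "(j < i \<and> i' < i \<longrightarrow> \<psi> a = 0) \<and> (i < j \<and> i < i' \<longrightarrow> \<theta> a = 0)"
      by (auto simp: position_functional_def peaks_def bottoms_def idx split: if_splits)
    moreover have "i \<noteq> j" using Cons.prems(1) by (auto simp: distinct_adj_Cons)
    ultimately show ?thesis by (simp add: as as' idx)
  qed
qed simp

text \<open>The first letter lies in the kernel of \<open>\<chi>\<close>, so only the runs that keep
  it on the stack remain, and these contribute nothing by \<open>run_kernel_word\<close>.\<close>

lemma vanishes_on_kernels_state: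
  assumes "unital_functional \<chi>"
  shows "vanishes_on_kernels (\<lambda>_::'i::linorder. \<chi>) (\<lambda>_. \<psi>) (\<lambda>_. \<theta>) (state \<chi>)"
  unfolding vanishes_on_kernels_def
proof (intro allI impI, elim conjE)
  fix idx :: "'i list" and as
  assume *: "idx \<noteq> []" "distinct_adj idx" "length as = length idx"
    "\<forall>k<length idx. position_functional (\<lambda>_. \<chi>) (\<lambda>_. \<psi>) (\<lambda>_. \<theta>) idx k (as ! k) = 0"
  obtain i idx' where idx: "idx = i # idx'" using *(1) by (cases idx) auto
  obtain a as' where as: "as = a # as'" using *(3) idx by (cases as) auto
  have "kernel_word i (zip idx' as')"
    by (rule kernel_word_positions[where \<chi> = \<chi>]) (use * in \<open>auto simp: idx as\<close>)
  moreover from this have "fst (hd (zip idx' as')) \<noteq> i" if "zip idx' as' \<noteq> []"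
    using that by (cases "(i, zip idx' as')" rule: kernel_word.cases) auto
  ultimately have "run \<chi> (zip idx' as') null_stack [(i, b)] = 0" for b
    by (intro run_kernel_word) auto
  moreover have "\<chi> a = 0"
    using *(4) by (auto simp: idx as position_functional_def)
  ultimately have "run \<chi> (zip idx as) null_stack [] = 0"
    by (simp add: idx as push_fresh)
  then show "state \<chi> (prod_list (map2 embed idx as)) = 0"
    using state_word[OF assms, of "zip idx as"] by simp
qed

end

section \<open>Uniqueness of the \<alpha>-free product\<close>

lemma embed_add: "embed i (a + b) = embed i a + embed i b"
  by transfer (rule free_product_ideal.gen_add)

lemma embed_mult: "embed i (a * b) = embed i a * embed i b"
  by transfer (rule free_product_ideal.gen_mult)

lemma embed_scale: "embed i (c *\<^sub>C a) = c *\<^sub>C embed i a"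
  by transfer (rule free_product_ideal.gen_scale)

lemma embed_one: "embed i 1 = 1"
  by transfer (rule free_product_ideal.gen_one)

lemma embed_diff: "embed i (a - b) = embed i a - embed i b"
  using embed_add[of i "a - b" b] by simp

context functional_pair
begin

context
  fixes \<chi> :: "'a \<Rightarrow> complex" and F :: "('i::linorder, 'a) free_product \<Rightarrow> complex"
  assumes unital_\<chi>: "unital_functional \<chi>" and unital_F: "unital_functional F"
    and vanishes: "vanishes_on_kernels (\<lambda>_. \<chi>) (\<lambda>_. \<psi>) (\<lambda>_. \<theta>) F"
begin

text \<open>Centredness read from the bottom up, so that the entry below position \<open>k\<close>
  is at position \<open>k - 1\<close>, as in a word.\<close>

lemma centred_nth_rev:
  assumes "centred \<chi> s" "k < length s"
  shows "(if k = 0 then \<chi>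
          else if rev (map fst s) ! (k - 1) < rev (map fst s) ! k then \<psi> else \<theta>)
         (rev (map snd s) ! k) = 0"
  using assms
proof (induction s)
  case (Cons x s)
  obtain i b where x: "x = (i, b)" by force
  show ?case
  proof (cases "k < length s")
    case True
    then show ?thesis using Cons x by (auto simp: nth_append)
  next
    case False
    then have k: "k = length s" using Cons.prems by simp
    show ?thesis
    proof (cases s)
      case Nil
      then show ?thesis using Cons.prems k x by simp
    next
      case (Cons y s')
      then show ?thesis using Cons.prems k x by (cases y) (auto simp: nth_append split: if_splits)
    qed
  qed
qed simp

lemma distinct_adj_centred: "centred \<chi> s \<Longrightarrow> distinct_adj (map fst s)"
  by (induction s rule: centred.induct) (auto simp: distinct_adj_Cons fresh_def hd_map)

text \<open>Read from the bottom, a centred stack meets the kernel conditions of the \<alpha>-free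
  product: the label before a peak is smaller and the label before a bottom is larger, which are the
  cases where \<open>pick\<close> yields \<psi> and \<theta>.\<close>

lemma vanishes_centred:
  assumes "centred \<chi> s"
  shows "F (prod_list (map (\<lambda>(i, a). embed i a) (rev s))) = null_stack s"
proof (cases "s = []")
  case True
  then show ?thesis by (simp add: unital_one[OF unital_F])
next
  case False
  define idx where "idx = rev (map fst s)"
  define as where "as = rev (map snd s)"
  have "F (prod_list (map2 embed idx as)) = 0"
  proof (rule vanishes[unfolded vanishes_on_kernels_def, rule_format], intro conjI allI impI)
    fix k assume "k < length idx"
    then show "position_functional (\<lambda>_. \<chi>) (\<lambda>_. \<psi>) (\<lambda>_. \<theta>) idx k (as ! k) = 0"
      using centred_nth_rev[OF assms, of k, folded idx_def as_def]
      by (auto simp: position_functional_def peaks_def bottoms_def idx_def split: if_splits)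
  qed (use False distinct_adj_centred[OF assms] in \<open>auto simp: idx_def as_def distinct_adj_rev\<close>)
  moreover have "map2 embed idx as = map (\<lambda>(i, a). embed i a) (rev s)"
    by (simp add: idx_def as_def rev_map zip_map_fst_snd)
  ultimately show ?thesis using False by (simp add: null_stack_def)
qed

text \<open>The split made by the machine is an identity in the free product, so \<open>F\<close> of
  the stack word times the unread rest obeys the recursion of \<open>run\<close>. At the end of the
  word \<open>vanishes_centred\<close> gives the value.\<close>

lemma vanishes_stack_word:
  assumes "centred \<chi> s"
  shows "F (prod_list (map (\<lambda>(i, a). embed i a) (rev s)) * prod_list (map (\<lambda>(i, a). embed i a) u))
    = run \<chi> u null_stack s"
  using assms
proof (induction u arbitrary: s)
  case Nil
  then show ?case by (simp add: vanishes_centred)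
next
  case (Cons x u)
  obtain i a where x: "x = (i, a)" by force
  define w where "w = prod_list (map (\<lambda>(i, a). embed i a) u)"
  let ?p = "\<lambda>s. prod_list (map (\<lambda>(i, a). embed i a) (rev s)) :: ('i, 'a) free_product"
  have step: "F (?p s' * (embed i b * w)) = run \<chi> u null_stack ((i, b - c *\<^sub>C 1) # s') +
      c * run \<chi> u null_stack s'"
    if "centred \<chi> s'" "fresh i s'" "c = pick \<chi> \<psi> \<theta> s' i b" for s' b c
  proof -
    have "centred \<chi> ((i, b - c *\<^sub>C 1) # s')"
      using that by (simp add: unital_simps[OF unital_pick[OF unital_\<chi>]])
    from Cons.IH[OF this] Cons.IH[OF that(1)] show ?thesis
      by (simp add: embed_diff embed_scale embed_one algebra_simps w_def unital_simps[OF unital_F]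
          scaleC_simps)
  qed
  show ?case
  proof (cases rule: top_cases[of s i])
    case (top b s')
    then show ?thesis
      using step[of s' _ "b * a"] Cons.prems
      by (simp add: x push_top w_def[symmetric] embed_mult mult.assoc)
  next
    case fresh
    then show ?thesis
      using step[of s _ a] Cons.prems by (simp add: x push_fresh w_def[symmetric])
  qed
qed

lemma vanishes_unique: "F = state \<chi>"
proof
  fix x
  have "F (abs_free_product y) = state \<chi> (abs_free_product y)" for y
  proof (induction y rule: free_alg_induct)
    case (single w c)
    have "Poly_Mapping.single w c = scalar c * Poly_Mapping.single w 1"
      by (simp add: scalar_def mult_single plus_list_def)
    then have "abs_free_product (Poly_Mapping.single w c) =
        c *\<^sub>C prod_list (map (\<lambda>(i, a). embed i a) w)"
      by (simp add: abs_free_product_word[symmetric] scaleC_free_product.abs_eq)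
    then show ?case
      using vanishes_stack_word[of "[]" w] state_word[OF unital_\<chi>, of w]
      by (simp add: unital_scale[OF unital_F] unital_scale[OF unital_state[OF unital_\<chi>]])
  next
    case (add x y)
    then show ?case
      by (simp add: unital_add[OF unital_F] unital_add[OF unital_state[OF unital_\<chi>]]
          flip: plus_free_product.abs_eq)
  qed
  from this[of "rep_free_product x"] show "F x = state \<chi> x"
    by (simp add: abs_rep)
qed

end

lemma alpha_free_product_eq:
  assumes "unital_functional \<phi>"
  shows "alpha_free_product (\<lambda>_::'i::linorder. \<phi>) (\<lambda>_. \<psi>) (\<lambda>_. \<theta>) = (state \<phi>, state \<psi>, state \<theta>)"
  unfolding alpha_free_product_def
proof (rule the_equality)
  show "is_alpha_free_product (\<lambda>_::'i. \<phi>) (\<lambda>_. \<psi>) (\<lambda>_. \<theta>) (state \<phi>, state \<psi>, state \<theta>)"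
    using assms unital_\<psi> unital_\<theta>
    by (simp add: is_alpha_free_product_def unital_state vanishes_on_kernels_state)
next
  fix T :: "(('i, 'a) free_product \<Rightarrow> complex) \<times> (('i, 'a) free_product \<Rightarrow> complex) \<times>
    (('i, 'a) free_product \<Rightarrow> complex)"
  assume "is_alpha_free_product (\<lambda>_. \<phi>) (\<lambda>_. \<psi>) (\<lambda>_. \<theta>) T"
  then show "T = (state \<phi>, state \<psi>, state \<theta>)"
    using assms unital_\<psi> unital_\<theta>
    by (cases T) (auto simp: is_alpha_free_product_def intro: vanishes_unique)
qed

end

section \<open>Products of sums of copies\<close>

definition over :: "'i set \<Rightarrow> ('i, 'a) free_alg set" where
  "over G = {x. \<forall>w\<in>Poly_Mapping.keys x. fst ` set w \<subseteq> G}"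

lemma over_letter: "i \<in> G \<Longrightarrow> letter i a \<in> over G"
  by (simp add: over_def letter_def)

lemma over_scalar: "scalar c \<in> over G"
  by (simp add: over_def scalar_def)

lemma over_one: "1 \<in> over G"
  using over_scalar[of 1] by (simp add: scalar_one)

lemma over_add: "x \<in> over G \<Longrightarrow> y \<in> over G \<Longrightarrow> x + y \<in> over G"
  using keys_add[of x y] by (auto simp: over_def)

lemma over_diff: "x \<in> over G \<Longrightarrow> y \<in> over G \<Longrightarrow> x - y \<in> over G"
  using keys_diff[of x y] by (auto simp: over_def)

lemma over_mult: "x \<in> over G \<Longrightarrow> y \<in> over G \<Longrightarrow> x * y \<in> over G"
  using keys_mult[of x y] by (force simp: over_def plus_list_def)

lemma over_sum: "(\<And>i. i \<in> I \<Longrightarrow> f i \<in> over G) \<Longrightarrow> (\<Sum>i\<in>I. f i) \<in> over G"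
  by (induction I rule: infinite_finite_induct) (auto simp: over_add, simp_all add: over_def)

lemma over_prod_list: "(\<And>x. x \<in> set xs \<Longrightarrow> x \<in> over G) \<Longrightarrow> prod_list xs \<in> over G"
  by (induction xs) (simp_all add: over_one over_mult)

text \<open>The analogue of \<open>N.a\<close> for group \<open>j\<close> of \<open>M\<close>
  consecutive labels, kept in the free algebra so that \<open>vacuum\<close> applies
  directly.\<close>

definition copies :: "nat \<Rightarrow> nat \<Rightarrow> 'a \<Rightarrow> (nat, 'a) free_alg" where
  "copies M j a = (\<Sum>l<M. letter (j * M + l) a)"

definition copies_word :: "nat \<Rightarrow> nat \<Rightarrow> 'a list \<Rightarrow> (nat, 'a) free_alg" where
  "copies_word M j as = prod_list (map (copies M j) as)"

lemma copies_word_over: "copies_word M j as \<in> over {j * M..<j * M + M}"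
  unfolding copies_word_def copies_def by (force intro: over_prod_list over_sum over_letter)

lemma prod_list_letters:
  "prod_list (map (\<lambda>(i, a). letter i a) w) = Poly_Mapping.single w 1"
proof (induction w)
  case Nil
  show ?case using scalar_one by (simp add: scalar_def)
next
  case (Cons x w)
  then show ?case by (cases x) (simp add: letter_def mult_single plus_list_def)
qed

lemma prod_list_sum:
  fixes f :: "'l \<Rightarrow> 'x \<Rightarrow> 'r::semiring_1"
  assumes "finite I"
  shows "prod_list (map (\<lambda>x. \<Sum>l\<in>I. f l x) xs) =
    (\<Sum>ls | set ls \<subseteq> I \<and> length ls = length xs. prod_list (map2 f ls xs))"
proof (induction xs)
  case Nil
  have "{ls. set ls \<subseteq> I \<and> length ls = length ([] :: 'x list)} = {[]}" by auto
  then show ?case by simp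
next
  case (Cons x xs)
  let ?L = "\<lambda>n. {ls. set ls \<subseteq> I \<and> length ls = n}"
  have "(\<Sum>ls\<in>?L (length (x # xs)). prod_list (map2 f ls (x # xs))) =
      (\<Sum>(l, ls)\<in>I \<times> ?L (length xs). prod_list (map2 f (l # ls) (x # xs)))"
    by (rule sum.reindex_bij_witness[of _ "\<lambda>(l, ls). l # ls" "\<lambda>ls. (hd ls, tl ls)"])
      (auto simp: length_Suc_conv)
  also have "\<dots> = (\<Sum>l\<in>I. f l x) * (\<Sum>ls\<in>?L (length xs). prod_list (map2 f ls xs))"
    by (simp add: sum.cartesian_product[symmetric] sum_product)
  finally show ?case using Cons by simp
qed

section \<open>Locality of the machine and invariance under increasing relabellings\<close>

context functional_pair
begin

text \<open>All labels of \<open>G\<close> see \<open>t\<close> in the same way and none merges into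
  it, so above \<open>t\<close> the machine works as on its own stack with bottom functional
  \<open>f\<close>. As \<open>h\<close> vanishes unless everything above \<open>t\<close> is gone,
  the value factors.\<close>

lemma run_local:
  assumes "\<And>i. i \<in> G \<Longrightarrow> pick \<chi> \<psi> \<theta> t i = f" "\<And>i. i \<in> G \<Longrightarrow> fresh i t"
    and "\<And>u. u \<noteq> [] \<Longrightarrow> fst ` set u \<subseteq> G \<Longrightarrow> h (u @ t) = 0"
    and "fst ` set w \<subseteq> G" "fst ` set u \<subseteq> G"
  shows "run \<chi> w h (u @ t) = h t * run f w null_stack u"
  using assms(4,5)
proof (induction w arbitrary: u)
  case Nil
  then show ?case using assms(3)[of u] by (cases "u = []") (auto simp: null_stack_def)
next
  case (Cons x w)
  obtain i a where x: "x = (i, a)" by force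
  have i: "i \<in> G" using Cons.prems x by simp
  have pick: "pick \<chi> \<psi> \<theta> (v @ t) i = pick f \<psi> \<theta> v i" for v
    using assms(1)[OF i] by (cases v) auto
  have fresh: "fresh i (v @ t) \<longleftrightarrow> fresh i v" for v
    using assms(2)[OF i] by (cases v) auto
  have IH: "run \<chi> w h ((i, b) # v @ t) = h t * run f w null_stack ((i, b) # v)"
    "run \<chi> w h (v @ t) = h t * run f w null_stack v"
    if "fst ` set v \<subseteq> G" for b v
    using Cons.IH[of "(i, b) # v"] Cons.IH[of v] Cons.prems(1) i that by auto
  show ?case
  proof (cases rule: top_cases[of u i])
    case (top b v)
    then show ?thesis
      using Cons.prems(2) by (simp add: x push_top pick IH algebra_simps)
  next
    case fresh': fresh
    then show ?thesis
      using Cons.prems(2) by (simp add: x push_fresh pick fresh IH algebra_simps)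
  qed
qed

lemma lin_run_local:
  assumes "\<And>i. i \<in> G \<Longrightarrow> pick \<chi> \<psi> \<theta> t i = f" "\<And>i. i \<in> G \<Longrightarrow> fresh i t"
    and "\<And>u. u \<noteq> [] \<Longrightarrow> fst ` set u \<subseteq> G \<Longrightarrow> h (u @ t) = 0"
    and "x \<in> over G"
  shows "lin_run \<chi> x h t = h t * vacuum f x"
proof -
  have "run \<chi> w h t = h t * run f w null_stack []" if "w \<in> Poly_Mapping.keys x" for w
    using run_local[where G = G and \<chi> = \<chi> and h = h and t = t and f = f and w = w and u = "[]",
        OF assms(1) assms(2) assms(3)] assms(4) that
    by (auto simp: over_def)
  then show ?thesis
    by (simp add: lin_run_def vacuum_def sum_distrib_left mult.left_commute)
qed

text \<open>Labels enter the machine only through equality and order.\<close>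

lemma run_relabel:
  assumes "strict_mono_on A r" "fst ` set w \<subseteq> A" "fst ` set s \<subseteq> A"
  shows "run \<chi> (map (apfst r) w) null_stack (map (apfst r) s) = run \<chi> w null_stack s"
  using assms(2,3)
proof (induction w arbitrary: s)
  case Nil
  then show ?case by (simp add: null_stack_def)
next
  case (Cons x w)
  obtain i a where x: "x = (i, a)" by force
  have i: "i \<in> A" using Cons.prems x by simp
  have pick: "pick \<chi> \<psi> \<theta> (map (apfst r) v) (r i) = pick \<chi> \<psi> \<theta> v i" if "fst ` set v \<subseteq> A" for v
    using that i strict_mono_on_less[OF assms(1)] by (cases v) (auto simp: pick_def)
  have fresh: "fresh (r i) (map (apfst r) v) \<longleftrightarrow> fresh i v" if "fst ` set v \<subseteq> A" for v
    using that i strict_mono_on_eqD[OF assms(1)] by (cases v) auto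
  have IH: "run \<chi> (map (apfst r) w) null_stack ((r i, b) # map (apfst r) v) =
      run \<chi> w null_stack ((i, b) # v)"
    "run \<chi> (map (apfst r) w) null_stack (map (apfst r) v) = run \<chi> w null_stack v"
    if "fst ` set v \<subseteq> A" for b v
    using Cons.IH[of "(i, b) # v"] Cons.IH[of v] Cons.prems(1) i that by auto
  show ?case
  proof (cases rule: top_cases[of s i])
    case (top b v)
    then show ?thesis
      using Cons.prems(2) by (simp add: x push_top pick IH)
  next
    case fresh': fresh
    then show ?thesis
      using Cons.prems(2) by (simp add: x push_fresh pick fresh IH)
  qed
qed

lemma vacuum_copies:
  "vacuum \<chi> (prod_list (map (\<lambda>(j, a). copies M j a) u)) =
     (\<Sum>ls | set ls \<subseteq> {..<M} \<and> length ls = length u.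
        run \<chi> (map2 (\<lambda>l (j, a). (j * M + l, a)) ls u) null_stack [])"
proof -
  have copies: "(\<lambda>(j, a). copies M j a) = (\<lambda>x. \<Sum>l<M. case x of (j, a) \<Rightarrow> letter (j * M + l) a)"
    by (auto simp: copies_def)
  have words: "prod_list (map2 (\<lambda>l. \<lambda>(j, a). letter (j * M + l) a) ls u) =
      Poly_Mapping.single (map2 (\<lambda>l (j, a). (j * M + l, a)) ls u) 1" for ls
    unfolding prod_list_letters[symmetric] by (simp add: case_prod_unfold comp_def)
  show ?thesis
    unfolding copies prod_list_sum[OF finite_lessThan] vacuum_sum words vacuum_single by simp
qed

lemma vacuum_copies_relabel:
  assumes "strict_mono_on (fst ` set u) r"
  shows "vacuum \<chi> (prod_list (map (\<lambda>(j, a). copies M (r j) a) u)) =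
    vacuum \<chi> (prod_list (map (\<lambda>(j, a). copies M j a) u))"
proof -
  \<comment> \<open>\<open>r'\<close> moves group \<open>j\<close> as a whole to group
    \<open>r j\<close> and keeps the place within the group. It is increasing on \<open>A\<close>
    because groups are disjoint intervals ordered by their numbers.\<close>
  define r' where "r' = (\<lambda>x. r (x div M) * M + x mod M)"
  define A where "A = {j * M + l |j l. j \<in> fst ` set u \<and> l < M}"
  have r': "r' (j * M + l) = r j * M + l" if "l < M" for j l
    using that by (simp add: r'_def)
  have block: "j * M + l < j' * M + l'" if "j < j'" "l < M" for j j' l l' :: nat
  proof -
    have "j * M + l < Suc j * M" using that by simp
    also have "\<dots> \<le> j' * M" using that by (intro mult_le_mono1) simp
    finally show ?thesis by simp
  qed
  have mono: "strict_mono_on A r'"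
  proof (rule strict_mono_onI)
    fix x y assume "x \<in> A" "y \<in> A" "x < y"
    obtain j l where x: "x = j * M + l" "j \<in> fst ` set u" "l < M"
      using \<open>x \<in> A\<close> unfolding A_def by blast
    obtain j' l' where y: "y = j' * M + l'" "j' \<in> fst ` set u" "l' < M"
      using \<open>y \<in> A\<close> unfolding A_def by blast
    note * = x y
    have "\<not> j' < j" using block[of j' j l' l] \<open>x < y\<close> * by auto
    then consider "j < j'" | "j = j'" by linarith
    then show "r' x < r' y"
    proof cases
      case 1
      then have "r j < r j'" using * assms by (auto simp: strict_mono_on_def)
      then show ?thesis using block[of "r j" "r j'" l l'] * by (simp add: r')
    next
      case 2
      then show ?thesis using * \<open>x < y\<close> by (simp add: r')
    qed
  qed
  have words: "run \<chi> (map2 (\<lambda>l (j, a). (j * M + l, a)) ls (map (apfst r) u)) null_stack [] =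
      run \<chi> (map2 (\<lambda>l (j, a). (j * M + l, a)) ls u) null_stack []"
    if ls: "set ls \<subseteq> {..<M}" "length ls = length u" for ls
  proof -
    have less: "l < M" if "(l, x) \<in> set (zip ls u)" for l x
      using set_zip_leftD[OF that] ls by auto
    have eq: "map2 (\<lambda>l (j, a). (j * M + l, a)) ls (map (apfst r) u) =
        map (apfst r') (map2 (\<lambda>l (j, a). (j * M + l, a)) ls u)"
      using less by (auto simp: r' zip_map2)
    have sub: "fst ` set (map2 (\<lambda>l (j, a). (j * M + l, a)) ls u) \<subseteq> A"
      using less by (force simp: A_def dest: set_zip_rightD)
    show ?thesis
      unfolding eq using run_relabel[OF mono sub, of "[]"] by simp
  qed
  have relabel: "map (\<lambda>(j, a). copies M (r j) a) u = map (\<lambda>(j, a). copies M j a) (map (apfst r) u)"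
    by auto
  show ?thesis
    unfolding relabel vacuum_copies using words by (intro sum.cong) auto
qed

section \<open>Stacks whose entries are words in whole groups of copies\<close>

definition moment :: "('a \<Rightarrow> complex) \<Rightarrow> nat \<Rightarrow> 'a list \<Rightarrow> complex" where
  "moment f M as = vacuum f (copies_word M 0 as)"

lemma vacuum_copies_word: "vacuum f (copies_word M j as) = moment f M as"
proof -
  have "strict_mono_on (fst ` set (map (Pair j) as)) (\<lambda>_. 0 :: nat)"
    by (auto simp: strict_mono_on_def)
  from vacuum_copies_relabel[OF this, of f M] show ?thesis
    by (simp add: moment_def copies_word_def comp_def)
qed

definition pick_moment ::
  "('a \<Rightarrow> complex) \<Rightarrow> nat \<Rightarrow> (nat \<times> 'a list) list \<Rightarrow> nat \<Rightarrow> 'a list \<Rightarrow> complex" where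
  "pick_moment \<chi> M s j = moment (pick \<chi> \<psi> \<theta> s j) M"

text \<open>The element of the free algebra that a stack of group words stands for: each word is
  centred by its moment under the functional chosen by the group below, and the bottom of the stack
  is the leftmost factor.\<close>

primrec copies_stack ::
  "('a \<Rightarrow> complex) \<Rightarrow> nat \<Rightarrow> (nat \<times> 'a list) list \<Rightarrow> (nat, 'a) free_alg" where
  "copies_stack \<chi> M [] = 1"
| "copies_stack \<chi> M (x # s) = copies_stack \<chi> M s *
     (copies_word M (fst x) (snd x) - scalar (pick_moment \<chi> M s (fst x) (snd x)))"

text \<open>The rightmost factor is centred. Over a stack topped by the group below,
  \<open>lin_run_local\<close> turns it into its vacuum value, which is \<open>0\<close>; this
  reproduces the assumption on \<open>h\<close> one group further down.\<close>

lemma copies_stack_vanishes: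
  assumes "distinct_adj (map fst ((j, ws) # s))"
    and "\<And>t. t \<noteq> [] \<Longrightarrow> fst (hd t) \<in> {j * M..<j * M + M} \<Longrightarrow> h t = 0"
  shows "lin_run \<chi> (copies_stack \<chi> M ((j, ws) # s)) h [] = 0"
  using assms
proof (induction s arbitrary: j ws h)
  case Nil
  let ?y = "copies_word M j ws - scalar (pick_moment \<chi> M [] j ws)"
  have "lin_run \<chi> ?y h [] = h [] * vacuum \<chi> ?y"
  proof (rule lin_run_local[where G = "{j * M..<j * M + M}"])
    show "h (u @ []) = 0" if "u \<noteq> []" "fst ` set u \<subseteq> {j * M..<j * M + M}" for u
      using that Nil.prems(2)[of u] by (cases u) auto
  qed (auto intro: over_diff copies_word_over over_scalar)
  then show ?case
    by (simp add: vacuum_diff vacuum_scalar vacuum_copies_word pick_moment_def)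
next
  case (Cons x s)
  obtain j' ws' where x: "x = (j', ws')" by force
  let ?f = "pick \<chi> \<psi> \<theta> ((j', ws') # s) j"
  let ?y = "copies_word M j ws - scalar (pick_moment \<chi> M ((j', ws') # s) j ws)"
  have "lin_run \<chi> ?y h t = 0" if t: "t \<noteq> []" "fst (hd t) \<in> {j' * M..<j' * M + M}" for t
  proof -
    have block: "i' < i" if "m' < m" "i' < m' * M + M" "m * M \<le> i" for i i' m m'
    proof -
      have "Suc m' * M \<le> m * M" using that by (intro mult_le_mono1) simp
      then show ?thesis using that by simp
    qed
    have "j' \<noteq> j" using Cons.prems(1) by (simp add: x distinct_adj_Cons)
    moreover obtain i' b t' where t': "t = (i', b) # t'" using t(1) by (cases t) auto
    \<comment> \<open>Groups are intervals, so every label of group \<open>j\<close> compares with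
      \<open>i'\<close> as \<open>j\<close> compares with \<open>j'\<close>.\<close>
    ultimately have sep: "i \<noteq> i' \<and> (i' < i \<longleftrightarrow> j' < j)" if "i \<in> {j * M..<j * M + M}" for i
      using t(2) block[of j' j i' i] block[of j j' i i'] that by (auto simp: neq_iff)
    have "lin_run \<chi> ?y h t = h t * vacuum ?f ?y"
    proof (rule lin_run_local[where G = "{j * M..<j * M + M}"])
      show "h (u @ t) = 0" if "u \<noteq> []" "fst ` set u \<subseteq> {j * M..<j * M + M}" for u
        using that Cons.prems(2)[of "u @ t"] by (cases u) auto
    qed (use sep in \<open>auto simp: t' intro: over_diff copies_word_over over_scalar\<close>)
    then show ?thesis
      by (simp add: vacuum_diff vacuum_scalar vacuum_copies_word pick_moment_def)
  qed
  then have "lin_run \<chi> (copies_stack \<chi> M ((j', ws') # s)) (lin_run \<chi> ?y h) [] = 0"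
    using Cons.prems(1) by (intro Cons.IH) (auto simp: x distinct_adj_Cons)
  moreover have "copies_stack \<chi> M ((j, ws) # x # s) = copies_stack \<chi> M ((j', ws') # s) * ?y"
    by (simp add: x)
  ultimately show ?case by (simp only: lin_run_mult)
qed

definition copies_value ::
  "('a \<Rightarrow> complex) \<Rightarrow> nat \<Rightarrow> (nat \<times> 'a) list \<Rightarrow> (nat \<times> 'a list) list \<Rightarrow> complex" where
  "copies_value \<chi> M u s =
     vacuum \<chi> (copies_stack \<chi> M s * prod_list (map (\<lambda>(j, a). copies M j a) u))"

lemma copies_value_Nil: "distinct_adj (map fst s) \<Longrightarrow> copies_value \<chi> M [] s = null_stack s"
proof (cases s)
  case (Cons x s')
  assume "distinct_adj (map fst s)"
  then show ?thesis
    using copies_stack_vanishes[of "fst x" "snd x" s' M null_stack \<chi>] Cons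
    by (simp add: copies_value_def vacuum_def null_stack_def)
qed (simp add: copies_value_def vacuum_one)

text \<open>A group word is its centred part plus a scalar: the split of the stack machine, now made
  for a whole group.\<close>

lemma copies_value_shift:
  "vacuum \<chi> (copies_stack \<chi> M s * (copies_word M j ws * prod_list (map (\<lambda>(j, a). copies M j a) u)))
   = copies_value \<chi> M u ((j, ws) # s) + pick_moment \<chi> M s j ws * copies_value \<chi> M u s"
proof -
  let ?u = "prod_list (map (\<lambda>(j, a). copies M j a) u)"
  let ?c = "pick_moment \<chi> M s j ws"
  have "copies_stack \<chi> M s * (copies_word M j ws * ?u) =
      copies_stack \<chi> M ((j, ws) # s) * ?u + scalar ?c * (copies_stack \<chi> M s * ?u)"
    by (simp add: algebra_simps scalar_central)
  then show ?thesis
    by (simp add: copies_value_def vacuum_add vacuum_scalar_mult)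
qed

lemma copies_value_fresh:
  "copies_value \<chi> M ((j, a) # u) s =
     copies_value \<chi> M u ((j, [a]) # s) + pick_moment \<chi> M s j [a] * copies_value \<chi> M u s"
  using copies_value_shift[of \<chi> M s j "[a]" u] by (simp add: copies_value_def copies_word_def)

text \<open>The top entry is a centred word, so a further letter gives the longer word minus a
  multiple of the single letter. The subtracted terms carry an additional moment and drop out at
  leading order.\<close>

lemma copies_value_top:
  "copies_value \<chi> M ((j, a) # u) ((j, ws) # s) =
     copies_value \<chi> M u ((j, ws @ [a]) # s) + pick_moment \<chi> M s j (ws @ [a]) * copies_value \<chi> M u s
     - pick_moment \<chi> M s j ws *
       (copies_value \<chi> M u ((j, [a]) # s) + pick_moment \<chi> M s j [a] * copies_value \<chi> M u s)"
proof -
  let ?u = "prod_list (map (\<lambda>(j, a). copies M j a) u)"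
  let ?c = "pick_moment \<chi> M s j ws"
  have "copies_stack \<chi> M ((j, ws) # s) * (copies M j a * ?u) =
      copies_stack \<chi> M s * (copies_word M j (ws @ [a]) * ?u) -
      scalar ?c * (copies_stack \<chi> M s * (copies_word M j [a] * ?u))"
    by (simp add: copies_word_def algebra_simps scalar_central)
  then have "copies_value \<chi> M ((j, a) # u) ((j, ws) # s) =
      vacuum \<chi> (copies_stack \<chi> M s * (copies_word M j (ws @ [a]) * ?u)) -
      ?c * vacuum \<chi> (copies_stack \<chi> M s * (copies_word M j [a] * ?u))"
    by (simp add: copies_value_def vacuum_diff vacuum_scalar_mult)
  then show ?thesis by (simp only: copies_value_shift)
qed

end

section \<open>Leading terms\<close>

text \<open>\<open>g(M) = c M^r + O(M^(r+1))\<close> with a polynomial remainder. The identity is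
  exact because \<open>value_at_one_from_leads\<close> substitutes \<open>1 / N\<close> for
  \<open>M\<close> in it.\<close>

definition lead :: "nat \<Rightarrow> complex \<Rightarrow> (nat \<Rightarrow> complex) \<Rightarrow> bool" where
  "lead r c g \<longleftrightarrow>
     (\<exists>q. \<forall>M. g M = of_nat M ^ r * (c + of_nat M * poly q (of_nat M)))"

lemma leadI: "(\<And>M. g M = of_nat M ^ r * (c + of_nat M * poly q (of_nat M))) \<Longrightarrow> lead r c g"
  by (auto simp: lead_def)

lemma lead_const: "lead 0 c (\<lambda>_. c)"
  by (rule leadI[where q = 0]) simp

lemma lead_zero: "lead r 0 (\<lambda>_. 0)"
  by (rule leadI[where q = 0]) simp

lemma lead_add:
  assumes "lead r c g" "lead r d h"
  shows "lead r (c + d) (\<lambda>M. g M + h M)"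
proof -
  obtain p q where "\<And>M. g M = of_nat M ^ r * (c + of_nat M * poly p (of_nat M))"
    "\<And>M. h M = of_nat M ^ r * (d + of_nat M * poly q (of_nat M))"
    using assms unfolding lead_def by blast
  then show ?thesis by (intro leadI[where q = "p + q"]) (simp add: algebra_simps)
qed

lemma lead_mult:
  assumes "lead r c g" "lead r' d h"
  shows "lead (r + r') (c * d) (\<lambda>M. g M * h M)"
proof -
  obtain p q where "\<And>M. g M = of_nat M ^ r * (c + of_nat M * poly p (of_nat M))"
    "\<And>M. h M = of_nat M ^ r' * (d + of_nat M * poly q (of_nat M))"
    using assms unfolding lead_def by blast
  then show ?thesis
    by (intro leadI[where q = "smult c q + smult d p + [:0, 1:] * p * q"])
      (simp add: algebra_simps power_add)
qed

lemma lead_uminus: "lead r c g \<Longrightarrow> lead r (- c) (\<lambda>M. - g M)"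
  using lead_mult[OF lead_const[of "-1"], of r c g] by simp

lemma lead_diff: "lead r c g \<Longrightarrow> lead r d h \<Longrightarrow> lead r (c - d) (\<lambda>M. g M - h M)"
  using lead_add[OF _ lead_uminus, of r c g d h] by simp

lemma lead_sum:
  "(\<And>i. i \<in> I \<Longrightarrow> lead r (c i) (g i)) \<Longrightarrow> lead r (\<Sum>i\<in>I. c i) (\<lambda>M. \<Sum>i\<in>I. g i M)"
  by (induction I rule: infinite_finite_induct) (simp_all add: lead_zero lead_add)

text \<open>A term of higher order counts as leading coefficient \<open>0\<close> at the lower
  order; this is how negligible terms are discarded.\<close>

lemma lead_Suc:
  assumes "lead (Suc r) c g"
  shows "lead r 0 g"
proof -
  obtain q where "\<And>M. g M = of_nat M ^ Suc r * (c + of_nat M * poly q (of_nat M))"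
    using assms unfolding lead_def by blast
  then show ?thesis by (intro leadI[where q = "pCons c q"]) (simp add: algebra_simps)
qed

lemma poly_eqI_of_nat:
  fixes p q :: "complex poly"
  assumes "\<And>N::nat. poly p (of_nat N) = poly q (of_nat N)"
  shows "p = q"
proof (rule ccontr)
  assume "p \<noteq> q"
  then have "finite {x. poly (p - q) x = 0}" by (intro poly_roots_finite) simp
  moreover have "range (of_nat :: nat \<Rightarrow> complex) \<subseteq> {x. poly (p - q) x = 0}"
    using assms by auto
  ultimately have "finite (range (of_nat :: nat \<Rightarrow> complex))" by (rule finite_subset[rotated])
  then show False
    using finite_imageD[of "of_nat :: nat \<Rightarrow> complex" UNIV] inj_of_nat by auto
qed

lemma linear_coeff_poly:
  assumes "\<And>N. f N = poly p (of_nat N)"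
  shows "linear_coeff f = coeff p 1"
proof -
  have "(THE q. \<forall>N. poly q (of_nat N) = f N) = p"
    using assms by (intro the_equality poly_eqI_of_nat) auto
  then show ?thesis by (simp add: linear_coeff_def)
qed

lemma lead_linear_coeff:
  assumes "\<And>N. f N = poly p (of_nat N)" "f 0 = 0"
  shows "lead 1 (linear_coeff f) f"
proof -
  obtain c q where p: "p = pCons 0 (pCons c q)"
    using assms(1)[of 0] assms(2) by (cases p, cases "tl (coeffs p)") (metis pCons_cases poly_pCons
      add.right_neutral mult_zero_left of_nat_0)+
  show ?thesis
    unfolding linear_coeff_poly[OF assms(1)]
    by (rule leadI[where q = q]) (simp add: assms(1) p algebra_simps)
qed

definition choose_poly :: "nat \<Rightarrow> complex poly" where
  "choose_poly k = smult (1 / fact k) (\<Prod>i<k. [:- of_nat i, 1:])"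

lemma poly_choose_poly: "poly (choose_poly k) (of_nat N) = of_nat (N choose k)"
  by (simp add: choose_poly_def binomial_gbinomial gbinomial_prod_rev poly_prod
      atLeast0LessThan)

text \<open>The source of the inverse factorials in the formulas.\<close>

lemma choose_over_power_tendsto:
  "(\<lambda>N. of_nat (N choose k) / of_nat N ^ k :: complex) \<longlonglongrightarrow> 1 / fact k"
proof -
  have "(\<lambda>N. of_nat i / of_nat N :: complex) \<longlonglongrightarrow> 0" for i
    by (rule tendsto_divide_0[OF tendsto_const]) (rule tendsto_of_nat)
  then have "(\<lambda>N. (\<Prod>i<k. 1 - of_nat i / of_nat N) / fact k :: complex)
      \<longlonglongrightarrow> (\<Prod>i<k. 1 - 0) / fact k"
    by (intro tendsto_intros) auto
  moreover have "(\<Prod>i<k. 1 - of_nat i / of_nat N) / fact k =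
      (of_nat (N choose k) / of_nat N ^ k :: complex)" if "N > 0" for N
  proof -
    have "(\<Prod>i<k. 1 - of_nat i / of_nat N :: complex) = (\<Prod>i<k. (of_nat N - of_nat i) / of_nat N)"
      using that by (intro prod.cong) (auto simp: diff_divide_distrib)
    also have "\<dots> = (\<Prod>i<k. of_nat N - of_nat i) / of_nat N ^ k"
      by (simp add: prod_dividef)
    finally show ?thesis
      by (simp add: binomial_gbinomial gbinomial_prod_rev atLeast0LessThan)
  qed
  ultimately show ?thesis
    by (auto intro: Lim_transform_eventually eventually_mono[OF eventually_gt_at_top[of 0]])
qed

text \<open>The identity holds at \<open>M = 1 / N\<close>, since both sides are polynomials in \<open>M\<close>;
  then let \<open>N\<close> tend to infinity.\<close>

lemma value_at_one_from_leads:
  assumes "\<And>N M. poly p (of_nat (N * M)) = (\<Sum>k\<le>n. of_nat (N choose k) * R k M)"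
    and "\<And>k. lead k (c k) (R k)"
  shows "poly p 1 = (\<Sum>k\<le>n. c k / fact k)"
proof -
  have "\<forall>k. \<exists>q. \<forall>M. R k M = of_nat M ^ k * (c k + of_nat M * poly q (of_nat M))"
    using assms(2) by (simp add: lead_def)
  from choice[OF this] obtain q
    where q: "\<And>k M. R k M = of_nat M ^ k * (c k + of_nat M * poly (q k) (of_nat M))"
    by blast
  have "poly p 1 = (\<Sum>k\<le>n. of_nat (N choose k) / of_nat N ^ k *
      (c k + inverse (of_nat N) * poly (q k) (inverse (of_nat N))))" if "N > 0" for N
  proof -
    let ?Q = "\<Sum>k\<le>n. smult (of_nat (N choose k)) ([:0, 1:] ^ k * ([:c k:] + [:0, 1:] * q k))"
    have "pcompose p [:0, of_nat N:] = ?Q"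
    proof (rule poly_eqI_of_nat)
      fix M
      show "poly (pcompose p [:0, of_nat N:]) (of_nat M) = poly ?Q (of_nat M)"
        using assms(1)[of N M]
        by (simp add: poly_pcompose poly_sum q algebra_simps)
    qed
    then have "poly (pcompose p [:0, of_nat N:]) (inverse (of_nat N)) =
        poly ?Q (inverse (of_nat N))"
      by simp
    then show ?thesis
      using that by (simp add: poly_pcompose poly_sum power_inverse divide_inverse algebra_simps)
  qed
  then have "(\<lambda>N. \<Sum>k\<le>n. of_nat (N choose k) / of_nat N ^ k *
      (c k + inverse (of_nat N) * poly (q k) (inverse (of_nat N)))) \<longlonglongrightarrow> poly p 1"
    by (intro tendsto_eventually eventually_mono[OF eventually_gt_at_top[of 0]]) auto
  moreover have inv: "(\<lambda>N. inverse (of_nat N) :: complex) \<longlonglongrightarrow> 0"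
    by (rule tendsto_inverse_0[THEN filterlim_compose]) (rule tendsto_of_nat)
  then have "(\<lambda>N. poly (q k) (inverse (of_nat N))) \<longlonglongrightarrow> poly (q k) 0" for k
    by (rule isCont_tendsto_compose[rotated]) simp
  then have "(\<lambda>N. \<Sum>k\<le>n. of_nat (N choose k) / of_nat N ^ k *
      (c k + inverse (of_nat N) * poly (q k) (inverse (of_nat N)))) \<longlonglongrightarrow>
      (\<Sum>k\<le>n. 1 / fact k * (c k + 0 * poly (q k) 0))"
    by (intro tendsto_intros choose_over_power_tendsto inv)
  ultimately have "poly p 1 = (\<Sum>k\<le>n. 1 / fact k * (c k + 0 * poly (q k) 0))"
    by (rule LIMSEQ_unique)
  then show ?thesis by simp
qed

text \<open>Lists are grouped by their set \<open>S\<close> of entries. The increasing enumeration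
  of \<open>S\<close> identifies them with the lists onto \<open>{..<k}\<close>, where
  \<open>k = card S\<close>, and there are \<open>N choose k\<close> such sets. Since a list of
  length \<open>n\<close> has at most \<open>n\<close> distinct entries, the right side is
  polynomial in \<open>N\<close>.\<close>

lemma sum_lists_by_range:
  fixes v :: "nat list \<Rightarrow> complex"
  assumes v: "\<And>ls r. strict_mono_on (set ls) r \<Longrightarrow> length ls = n \<Longrightarrow> v (map r ls) = v ls"
  shows "(\<Sum>ls | set ls \<subseteq> {..<N} \<and> length ls = n. v ls) =
    (\<Sum>k\<le>n. of_nat (N choose k) * (\<Sum>ls | set ls = {..<k} \<and> length ls = n. v ls))"
proof -
  define V where "V = (\<lambda>k. \<Sum>ls | set ls = {..<k} \<and> length ls = n. v ls)"
  have range: "(\<Sum>ls | set ls = S \<and> length ls = n. v ls) = V (card S)" if "finite S" for S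
  proof -
    define e where "e = (\<lambda>i. sorted_list_of_set S ! i)"
    have mono: "strict_mono_on {..<card S} e"
      using that sorted_list_of_set.strict_sorted_key_list_of_set[of S]
      by (auto simp: strict_mono_on_def e_def sorted_wrt_iff_nth_less)
    have im: "e ` {..<card S} = S"
      using set_conv_nth[of "sorted_list_of_set S"] that by (auto simp: e_def image_def)
    have inj: "inj_on e {..<card S}"
      using mono by (rule strict_mono_on_imp_inj_on)
    have "{ls. set ls = S \<and> length ls = n} = map e ` {ls. set ls = {..<card S} \<and> length ls = n}"
    proof (intro equalityI subsetI)
      fix ls assume "ls \<in> {ls. set ls = S \<and> length ls = n}"
      then have ls: "set ls = S" "length ls = n" by auto
      define g where "g = inv_into {..<card S} e"
      have "map e (map g ls) = ls"
        using ls im by (auto simp: g_def f_inv_into_f intro!: map_idI)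
      moreover have "set (map g ls) = {..<card S}"
        using inv_into_image_cancel[OF inj order_refl] im ls by (simp add: g_def)
      ultimately show "ls \<in> map e ` {ls. set ls = {..<card S} \<and> length ls = n}"
        using ls by (intro image_eqI[of _ _ "map g ls"]) auto
    next
      fix ls assume "ls \<in> map e ` {ls. set ls = {..<card S} \<and> length ls = n}"
      then obtain ls' where "ls = map e ls'" "set ls' = {..<card S}" "length ls' = n" by blast
      then show "ls \<in> {ls. set ls = S \<and> length ls = n}" by (simp add: im)
    qed
    moreover have "inj_on (map e) {ls. set ls = {..<card S} \<and> length ls = n}"
      by (rule inj_on_mapI) (rule inj_on_subset[OF inj], auto)
    ultimately show ?thesis
      using mono by (simp add: V_def sum.reindex v)
  qed
  have "(\<Sum>ls | set ls \<subseteq> {..<N} \<and> length ls = n. v ls) =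
      (\<Sum>S\<in>Pow {..<N}. \<Sum>ls | ls \<in> {ls. set ls \<subseteq> {..<N} \<and> length ls = n} \<and> set ls = S. v ls)"
    by (rule sum.group[symmetric]) (auto simp: finite_lists_length_eq)
  also have "\<dots> = (\<Sum>S\<in>Pow {..<N}. V (card S))"
  proof (rule sum.cong)
    fix S assume S: "S \<in> Pow {..<N}"
    then have "{ls. ls \<in> {ls. set ls \<subseteq> {..<N} \<and> length ls = n} \<and> set ls = S} =
        {ls. set ls = S \<and> length ls = n}" by auto
    then show "(\<Sum>ls | ls \<in> {ls. set ls \<subseteq> {..<N} \<and> length ls = n} \<and> set ls = S. v ls) =
        V (card S)"
      using range[of S] S by (simp add: finite_subset)
  qed simp
  also have "\<dots> = (\<Sum>k\<le>N. \<Sum>S | S \<in> Pow {..<N} \<and> card S = k. V (card S))"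
    by (rule sum.group[symmetric]) (auto dest: card_mono[OF finite_lessThan])
  also have "\<dots> = (\<Sum>k\<le>N. of_nat (N choose k) * V k)"
  proof (rule sum.cong)
    fix k
    have "(\<Sum>S | S \<in> Pow {..<N} \<and> card S = k. V (card S)) =
        (\<Sum>S | S \<subseteq> {..<N} \<and> card S = k. V k)"
      by (rule sum.cong) auto
    then show "(\<Sum>S | S \<in> Pow {..<N} \<and> card S = k. V (card S)) = of_nat (N choose k) * V k"
      by (simp add: n_subsets)
  qed simp
  \<comment> \<open>Both ranges embed into \<open>max n N\<close>: the binomials vanish for
    \<open>k > N\<close>, and \<open>V k\<close> vanishes for \<open>k > n\<close>.\<close>
  also have "\<dots> = (\<Sum>k\<le>max n N. of_nat (N choose k) * V k)"
    by (rule sum.mono_neutral_left) auto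
  also have "\<dots> = (\<Sum>k\<le>n. of_nat (N choose k) * V k)"
  proof (rule sum.mono_neutral_right)
    have "V k = 0" if "k > n" for k
    proof -
      have "{ls. set ls = {..<k} \<and> length ls = n} = {}"
      proof (intro equals0I, elim CollectE conjE)
        fix ls :: "nat list" assume "set ls = {..<k}" "length ls = n"
        then show False using that card_length[of ls] by simp
      qed
      then show ?thesis by (simp only: V_def sum.empty)
    qed
    then show "\<forall>k\<in>{..max n N} - {..n}. of_nat (N choose k) * V k = 0" by auto
  qed auto
  finally show ?thesis by (simp add: V_def)
qed

lemma fst_set_zip: "length xs = length ys \<Longrightarrow> fst ` set (zip xs ys) = set xs"
  by (metis list.set_map map_fst_zip)

section \<open>Moments of sums of copies and their linear coefficients\<close>

context functional_pair
begin

lemma moment_sum_words: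
  "moment f M as =
     (\<Sum>ls | set ls \<subseteq> {..<M} \<and> length ls = length as. run f (zip ls as) null_stack [])"
proof -
  have "map2 (\<lambda>l (j, a). (j * M + l, a)) ls (map (Pair 0) as) = zip ls as" for ls
    by (simp add: zip_map2 case_prod_unfold comp_def)
  then show ?thesis
    using vacuum_copies[of f M "map (Pair 0) as"]
    by (simp add: moment_def copies_word_def comp_def)
qed

text \<open>By \<open>sum_lists_by_range\<close> the moment is a combination of binomials
  \<open>M choose k\<close> whose coefficients do not depend on \<open>M\<close>.\<close>

lemma moment_poly: "\<exists>p. \<forall>M. moment f M as = poly p (of_nat M)"
proof -
  define S where "S = (\<lambda>k. \<Sum>ls :: nat list | set ls = {..<k} \<and> length ls = length as.
    run f (zip ls as) null_stack [])"
  have relabel: "run f (zip (map r ls) as) null_stack [] = run f (zip ls as) null_stack []"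
    if "strict_mono_on (set ls) r" "length ls = length as" for ls :: "nat list" and r :: "nat \<Rightarrow> nat"
  proof -
    have "zip (map r ls) as = map (apfst r) (zip ls as)"
      by (auto simp: zip_map1)
    then show ?thesis
      using run_relabel[OF that(1), of "zip ls as" "[]"] that(2) by (simp add: fst_set_zip)
  qed
  have "moment f M as = (\<Sum>k\<le>length as. of_nat (M choose k) * S k)" for M
    unfolding moment_sum_words S_def by (rule sum_lists_by_range) (rule relabel)
  then show ?thesis
    by (intro exI[of _ "\<Sum>k\<le>length as. smult (S k) (choose_poly k)"])
      (simp add: poly_sum poly_choose_poly mult.commute)
qed

lemma moment_0: "as \<noteq> [] \<Longrightarrow> moment f 0 as = 0"
  by (cases as) (simp_all add: moment_def copies_word_def copies_def vacuum_def lin_run_zero)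

text \<open>The second conjunct, about a centred entry already on the stack, is what carries the
  induction.\<close>

lemma run_single_label:
  assumes "unital_functional f"
  shows "run f (map (Pair i) as) null_stack [] = f (prod_list as) \<and>
    (\<forall>b. f b = 0 \<longrightarrow> run f (map (Pair i) as) null_stack [(i, b)] = f (b * prod_list as))"
  by (induction as)
    (simp_all add: push_top push_fresh unital_simps[OF assms] scaleC_simps algebra_simps)

lemma moment_1:
  assumes "unital_functional f"
  shows "moment f 1 as = f (prod_list as)"
proof -
  have "copies 1 0 = (letter 0 :: 'a \<Rightarrow> (nat, 'a) free_alg)"
    by (simp add: copies_def fun_eq_iff)
  then have "copies_word 1 0 as = Poly_Mapping.single (map (Pair 0) as) 1"
    unfolding prod_list_letters[symmetric] by (simp add: copies_word_def comp_def)
  then show ?thesis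
    using run_single_label[OF assms, of "0 :: nat" as] by (simp add: moment_def vacuum_single)
qed

text \<open>\<open>f\<close> acts at the bottom of the stack, \<psi> and \<theta> above it. Taking
  \<phi>, \<psi>, \<theta> for \<open>f\<close> gives the \<alpha>-, \<beta>- and \<gamma>-free
  cumulants, see \<open>cumulant_eq\<close>.\<close>

definition cumulant :: "('a \<Rightarrow> complex) \<Rightarrow> 'a list \<Rightarrow> complex" where
  "cumulant f as = linear_coeff (\<lambda>N. moment f N as)"

lemma lead_moment:
  assumes "as \<noteq> []"
  shows "lead 1 (cumulant f as) (\<lambda>M. moment f M as)"
proof -
  obtain p where "\<And>M. moment f M as = poly p (of_nat M)"
    using moment_poly by blast
  then show ?thesis
    unfolding cumulant_def by (rule lead_linear_coeff) (rule moment_0[OF assms])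
qed

lemma state_dot:
  assumes "unital_functional f"
  shows "state f (prod_list (map (dot N) as)) = moment f N as"
proof -
  have "prod_list (map (dot N) as) =
      (\<Sum>ls | set ls \<subseteq> {..<N} \<and> length ls = length as. prod_list (map2 embed ls as))"
    unfolding dot_def by (rule prod_list_sum) simp
  moreover have "state f (prod_list (map2 embed ls as)) = run f (zip ls as) null_stack []"
    for ls :: "nat list"
    by (rule state_word[OF assms])
  ultimately show ?thesis
    by (simp add: unital_sum[OF unital_state[OF assms]] moment_sum_words)
qed

section \<open>The linearised machine\<close>

text \<open>The leading coefficient of \<open>copies_value\<close> in \<open>M\<close>. Each
  evaluation of a group costs a factor \<open>M\<close>, so the lowest order is the number of labels
  and is attained when every label is evaluated once. Hence the weight \<open>0\<close> if the label
  recurs in the unread word or lower in the stack.\<close>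

primrec linear_run ::
  "('a \<Rightarrow> complex) \<Rightarrow> (nat \<times> 'a) list \<Rightarrow> (nat \<times> 'a list) list \<Rightarrow> complex" where
  "linear_run \<chi> [] s = null_stack s"
| "linear_run \<chi> (x # u) s = (case x of (j, a) \<Rightarrow>
     (case (case s of [] \<Rightarrow> ([a], s) | (j', ws) # s' \<Rightarrow> if j' = j then (ws @ [a], s') else ([a], s)) of
        (ws, s') \<Rightarrow> linear_run \<chi> u ((j, ws) # s') +
          (if j \<in> fst ` set u \<union> fst ` set s' then 0
           else cumulant (pick \<chi> \<psi> \<theta> s' j) ws * linear_run \<chi> u s')))"

lemma linear_run_top:
  "linear_run \<chi> ((j, a) # u) ((j, ws) # s) = linear_run \<chi> u ((j, ws @ [a]) # s) +
     (if j \<in> fst ` set u \<union> fst ` set s then 0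
      else cumulant (pick \<chi> \<psi> \<theta> s j) (ws @ [a]) * linear_run \<chi> u s)"
  by simp

lemma linear_run_fresh:
  "fresh j s \<Longrightarrow> linear_run \<chi> ((j, a) # u) s = linear_run \<chi> u ((j, [a]) # s) +
     (if j \<in> fst ` set u \<union> fst ` set s then 0
      else cumulant (pick \<chi> \<psi> \<theta> s j) [a] * linear_run \<chi> u s)"
proof (cases s)
  case (Cons y s')
  assume "fresh j s"
  then show ?thesis using Cons by (cases y) simp
qed simp

declare linear_run.simps(2) [simp del]

text \<open>The exponent counts the labels still to be evaluated. Entries are nonempty because the
  moment of the empty word is \<open>1\<close> rather than \<open>O(M)\<close>.\<close>

lemma lead_copies_value:
  assumes "distinct_adj (map fst s)" "[] \<notin> snd ` set s"
  shows "lead (card (fst ` set u \<union> fst ` set s)) (linear_run \<chi> u s) (\<lambda>M. copies_value \<chi> M u s)"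
  using assms
proof (induction u arbitrary: s)
  case Nil
  show ?case
  proof (cases s)
    case Nil
    then show ?thesis using lead_const[of 1] by (simp add: copies_value_Nil)
  next
    case (Cons x s')
    then show ?thesis using Nil.prems lead_zero by (simp add: copies_value_Nil)
  qed
next
  case (Cons x u)
  obtain j a where x: "x = (j, a)" by force
  have moment: "lead 1 (cumulant (pick \<chi> \<psi> \<theta> s' j) ws) (\<lambda>M. pick_moment \<chi> M s' j ws)"
    if "ws \<noteq> []" for s' ws
    unfolding pick_moment_def using lead_moment[OF that] .
  let ?r = "\<lambda>s'. card (fst ` set ((j, a) # u) \<union> fst ` set s')"
  have step: "lead (?r s') (linear_run \<chi> u ((j, ws) # s') +
     (if j \<in> fst ` set u \<union> fst ` set s' then 0
      else cumulant (pick \<chi> \<psi> \<theta> s' j) ws * linear_run \<chi> u s'))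
     (\<lambda>M. copies_value \<chi> M u ((j, ws) # s') + pick_moment \<chi> M s' j ws * copies_value \<chi> M u s')"
    if "distinct_adj (map fst s')" "[] \<notin> snd ` set s'" "fresh j s'" "ws \<noteq> []" for ws s'
  proof (rule lead_add)
    have "distinct_adj (map fst ((j, ws) # s'))"
      using that by (cases s') auto
    from Cons.IH[OF this] show "lead (?r s') (linear_run \<chi> u ((j, ws) # s'))
        (\<lambda>M. copies_value \<chi> M u ((j, ws) # s'))"
      using that by (simp add: insert_commute Un_commute)
    have prod: "lead (Suc (card (fst ` set u \<union> fst ` set s')))
        (cumulant (pick \<chi> \<psi> \<theta> s' j) ws * linear_run \<chi> u s')
        (\<lambda>M. pick_moment \<chi> M s' j ws * copies_value \<chi> M u s')"
      using lead_mult[OF moment[OF that(4)] Cons.IH[OF that(1,2)]] by simp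
    show "lead (?r s') (if j \<in> fst ` set u \<union> fst ` set s' then 0
      else cumulant (pick \<chi> \<psi> \<theta> s' j) ws * linear_run \<chi> u s')
      (\<lambda>M. pick_moment \<chi> M s' j ws * copies_value \<chi> M u s')"
    proof (cases "j \<in> fst ` set u \<union> fst ` set s'")
      case True
      \<comment> \<open>Evaluating \<open>j\<close> here does not lower the number of labels, so the
        product is one order too high.\<close>
      then show ?thesis using lead_Suc[OF prod] by (auto simp: insert_absorb)
    next
      case False
      then show ?thesis using prod by simp
    qed
  qed
  show ?case
  proof (cases rule: top_cases[of s j])
    case (top ws s')
    then have s': "distinct_adj (map fst s')" "[] \<notin> snd ` set s'" "fresh j s'" "ws \<noteq> []"
      using Cons.prems by (cases s'; auto)+
    have r: "?r s = ?r s'" using top by (simp add: insert_absorb)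
    \<comment> \<open>The correction in \<open>copies_value_top\<close> has an extra moment as
      factor, hence leading coefficient \<open>0\<close>.\<close>
    have "lead (?r s) 0 (\<lambda>M. pick_moment \<chi> M s' j ws * (copies_value \<chi> M u ((j, [a]) # s') +
        pick_moment \<chi> M s' j [a] * copies_value \<chi> M u s'))"
      using lead_mult[OF moment[OF s'(4)] step[OF s'(1-3), of "[a]"]] unfolding r
      by (intro lead_Suc) simp
    from lead_diff[OF step[OF s'(1-3), of "ws @ [a]", folded r] this] show ?thesis
      by (simp add: x top linear_run_top copies_value_top)
  next
    case fresh
    then show ?thesis
      using step[OF Cons.prems fresh, of "[a]"]
      by (simp add: x linear_run_fresh copies_value_fresh)
  qed
qed

text \<open>The \<open>N M\<close> copies are cut into \<open>N\<close> groups of \<open>M\<close>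
  consecutive ones, and the product is expanded over the groups.\<close>

lemma moment_mult:
  "moment f (N * M) as =
     (\<Sum>is | set is \<subseteq> {..<N} \<and> length is = length as. copies_value f M (zip is as) [])"
proof -
  have copies: "copies (N * M) 0 = (\<lambda>a. \<Sum>j<N. copies M j a)"
  proof
    fix a
    have "copies M j a = (\<Sum>l\<in>{j * M..<j * M + M}. letter l a)" for j
      unfolding copies_def
      by (subst sum.atLeastLessThan_shift_0) (simp add: atLeast0LessThan)
    then show "copies (N * M) 0 a = (\<Sum>j<N. copies M j a)"
      using sum.nat_group[of "\<lambda>l. letter l a" M N] by (simp add: copies_def)
  qed
  show ?thesis
    unfolding moment_def copies_word_def copies prod_list_sum[OF finite_lessThan]
    by (simp add: vacuum_sum copies_value_def)
qed

text \<open>The left side is the moment of a single copy, that is \<open>p(1)\<close> for the moment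
  polynomial \<open>p\<close>; regrouping and leading coefficients compute \<open>p(1)\<close> a
  second time.\<close>

lemma unital_moment_formula:
  assumes "unital_functional \<chi>"
  shows "\<chi> (prod_list as) = (\<Sum>k\<le>length as.
    (\<Sum>is | set is = {..<k} \<and> length is = length as. linear_run \<chi> (zip is as) []) / fact k)"
proof -
  define R where "R = (\<lambda>k M. \<Sum>is | set is = {..<k} \<and> length is = length as.
    copies_value \<chi> M (zip is as) [])"
  obtain p where p: "\<And>M. moment \<chi> M as = poly p (of_nat M)"
    using moment_poly by blast
  have relabel: "copies_value \<chi> M (zip (map r ls) as) [] = copies_value \<chi> M (zip ls as) []"
    if "strict_mono_on (set ls) r" "length ls = length as" for ls :: "nat list" and r M
  proof -
    have "fst ` set (zip ls as) = set ls" using that(2) by (rule fst_set_zip)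
    moreover have "map (\<lambda>(j, a). copies M j a) (zip (map r ls) as) =
        map (\<lambda>(j, a). copies M (r j) a) (zip ls as)"
      by (auto simp: zip_map1)
    ultimately show ?thesis
      using vacuum_copies_relabel[of "zip ls as" r \<chi> M] that(1)
      by (simp add: copies_value_def)
  qed
  have "poly p (of_nat (N * M)) = (\<Sum>k\<le>length as. of_nat (N choose k) * R k M)" for N M
    unfolding p[symmetric] moment_mult R_def by (rule sum_lists_by_range) (rule relabel)
  moreover have "lead k (\<Sum>is | set is = {..<k} \<and> length is = length as.
      linear_run \<chi> (zip is as) []) (R k)" for k
    unfolding R_def
  proof (rule lead_sum)
    fix ls :: "nat list" assume "ls \<in> {ls. set ls = {..<k} \<and> length ls = length as}"
    then have "fst ` set (zip ls as) = {..<k}" by (simp add: fst_set_zip)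
    then show "lead k (linear_run \<chi> (zip ls as) []) (\<lambda>M. copies_value \<chi> M (zip ls as) [])"
      using lead_copies_value[of "[]" "zip ls as" \<chi>] by simp
  qed
  ultimately have "poly p 1 = (\<Sum>k\<le>length as.
    (\<Sum>is | set is = {..<k} \<and> length is = length as. linear_run \<chi> (zip is as) []) / fact k)"
    by (rule value_at_one_from_leads)
  then show ?thesis
    using p[of 1] moment_1[OF assms] by simp
qed

end

subsection \<open>Crossing words\<close>

context functional_pair
begin

text \<open>The hypotheses are the possible successors of one step, under the conditions for nonzero
  weight; this reduces the vanishing lemmas below to inductions on the word.\<close>

lemma linear_run_eq_0_cases:
  assumes "\<And>ws s'. s = (j, ws) # s' \<Longrightarrow> linear_run \<chi> u ((j, ws @ [a]) # s') = 0"
    and "\<And>ws s'. s = (j, ws) # s' \<Longrightarrow> j \<notin> fst ` set u \<Longrightarrow> j \<notin> fst ` set s' \<Longrightarrow>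
      linear_run \<chi> u s' = 0"
    and "fresh j s \<Longrightarrow> linear_run \<chi> u ((j, [a]) # s) = 0"
    and "fresh j s \<Longrightarrow> j \<notin> fst ` set u \<Longrightarrow> j \<notin> fst ` set s \<Longrightarrow> linear_run \<chi> u s = 0"
  shows "linear_run \<chi> ((j, a) # u) s = 0"
proof (cases rule: top_cases[of s j])
  case (top ws s')
  then show ?thesis using assms(1,2)[OF top] by (simp add: linear_run_top)
next
  case fresh
  then show ?thesis using assms(3,4)[OF fresh] by (simp add: linear_run_fresh)
qed

text \<open>An entry leaves the stack only when a letter with its label is read, so an entry whose
  label no longer occurs stays to the end.\<close>

lemma linear_run_unclosed: "\<not> fst ` set s \<subseteq> fst ` set u \<Longrightarrow> linear_run \<chi> u s = 0"
proof (induction u arbitrary: s)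
  case Nil
  then show ?case by (cases s) auto
next
  case (Cons x u)
  obtain j a where x: "x = (j, a)" by force
  show ?case
    unfolding x by (rule linear_run_eq_0_cases; rule Cons.IH) (use Cons.prems x in auto)
qed

text \<open>A label is never evaluated while it also occurs lower in the stack, so a repetition
  persists.\<close>

lemma linear_run_repeated: "\<not> distinct (map fst s) \<Longrightarrow> linear_run \<chi> u s = 0"
proof (induction u arbitrary: s)
  case Nil
  then show ?case by (cases s) auto
next
  case (Cons x u)
  obtain j a where x: "x = (j, a)" by force
  show ?case
    unfolding x by (rule linear_run_eq_0_cases; rule Cons.IH) (use Cons.prems in auto)
qed

text \<open>The entry \<open>q\<close> cannot be evaluated before its letter in \<open>u2\<close>.
  So when the displayed \<open>p\<close> is read, an older \<open>p\<close> still lies beneath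
  \<open>q\<close>: either the labels already repeat or a second \<open>p\<close> is pushed, and
  \<open>linear_run_repeated\<close> applies.\<close>

lemma linear_run_buried:
  assumes "p \<in> fst ` set s2" "q \<in> fst ` set u2"
  shows "linear_run \<chi> (u1 @ (p, a) # u2) (s1 @ (q, ws) # s2) = 0"
proof (induction u1 arbitrary: s1 ws)
  case Nil
  let ?s = "s1 @ (q, ws) # s2"
  show ?case
  proof (cases "distinct (map fst ?s)")
    case True
    have "p \<notin> set A \<and> p \<noteq> q" if "distinct (A @ q # B)" "p \<in> set B" for A B
      using that by auto
    from this[of "map fst s1" "map fst s2"] have "p \<notin> fst ` set s1 \<and> p \<noteq> q"
      using True assms(1) by simp
    then have fresh: "fresh p ?s" by (cases s1) auto
    define s where "s = ?s"
    have mem: "p \<in> fst ` set s" using assms(1) by (simp add: s_def image_Un)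
    then have "linear_run \<chi> u2 ((p, [a]) # s) = 0"
      by (intro linear_run_repeated) simp
    then show ?thesis
      using fresh mem unfolding append_Nil s_def[symmetric] by (simp add: linear_run_fresh)
  qed (use linear_run_repeated in simp)
next
  case (Cons x u1)
  obtain j b where x: "x = (j, b)" by force
  have "q \<in> fst ` set (u1 @ (p, a) # u2)" using assms by auto
  note q = this
  show ?case
    unfolding x append_Cons
  proof (rule linear_run_eq_0_cases)
    fix ws' s' assume top: "s1 @ (q, ws) # s2 = (j, ws') # s'"
    show "linear_run \<chi> (u1 @ (p, a) # u2) ((j, ws' @ [b]) # s') = 0"
      using Cons.IH[of "[]"] Cons.IH[of "(j, ws' @ [b]) # tl s1"] top by (cases s1) auto
    show "linear_run \<chi> (u1 @ (p, a) # u2) s' = 0" if "j \<notin> fst ` set (u1 @ (p, a) # u2)"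
      using Cons.IH[of "tl s1"] top q that by (cases s1) auto
  next
    show "linear_run \<chi> (u1 @ (p, a) # u2) ((j, [b]) # s1 @ (q, ws) # s2) = 0"
      using Cons.IH[of "(j, [b]) # s1"] by simp
    show "linear_run \<chi> (u1 @ (p, a) # u2) (s1 @ (q, ws) # s2) = 0"
      by (rule Cons.IH)
  qed
qed

text \<open>The label \<open>j\<close> stays on the stack until its displayed letter, and reading
  \<open>q\<close> puts \<open>q\<close> above it: the situation of
  \<open>linear_run_buried\<close>.\<close>

lemma linear_run_open_crossed:
  assumes "j \<in> fst ` set s" "j \<noteq> q" "q \<in> fst ` set u3"
  shows "linear_run \<chi> (u1 @ (q, b) # u2 @ (j, a) # u3) s = 0"
  using assms(1)
proof (induction u1 arbitrary: s)
  case Nil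
  show ?case
    unfolding append_Nil
  proof (rule linear_run_eq_0_cases)
    fix ws s' assume "s = (q, ws) # s'"
    then show "linear_run \<chi> (u2 @ (j, a) # u3) ((q, ws @ [b]) # s') = 0"
      using Nil assms linear_run_buried[where ?s1.0 = "[]", of j s' q u3] by auto
  next
    show "linear_run \<chi> (u2 @ (j, a) # u3) ((q, [b]) # s) = 0"
      using Nil assms linear_run_buried[where ?s1.0 = "[]", of j s q u3] by auto
  qed (use assms in auto)
next
  case (Cons x u1)
  obtain i c where x: "x = (i, c)" by force
  show ?case
    unfolding x append_Cons
    by (rule linear_run_eq_0_cases; rule Cons.IH) (use Cons.prems in auto)
qed

text \<open>The first \<open>j\<close> cannot be evaluated at once because \<open>j\<close> recurs;
  it is therefore on the stack when the rest is read, and \<open>linear_run_open_crossed\<close>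
  applies.\<close>

lemma linear_run_crossing:
  assumes "j \<noteq> q" "q \<in> fst ` set u4"
  shows "linear_run \<chi> (u1 @ (j, a) # u2 @ (q, b) # u3 @ (j, c) # u4) s = 0"
proof (induction u1 arbitrary: s)
  case Nil
  show ?case
    unfolding append_Nil
    by (rule linear_run_eq_0_cases; (rule linear_run_open_crossed)?) (use assms in auto)
next
  case (Cons x u1)
  obtain i d where x: "x = (i, d)" by force
  show ?case
    unfolding x append_Cons by (rule linear_run_eq_0_cases; rule Cons.IH)
qed

end

section \<open>Labellings and nearest covers\<close>

text \<open>An ordered set partition with \<open>k\<close> blocks, given by the number of the block
  of each position. Surjectivity says that no block is empty.\<close>

locale labelling =
  fixes n k :: nat and lab :: "nat \<Rightarrow> nat"
  assumes lab_image: "lab ` {1..n} = {..<k}"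
begin

definition block :: "nat \<Rightarrow> nat set" where
  "block j = {p \<in> {1..n}. lab p = j}"

definition blocks :: "nat set list" where
  "blocks = map block [0..<k]"

lemma mem_block [simp]: "p \<in> block j \<longleftrightarrow> p \<in> {1..n} \<and> lab p = j"
  by (auto simp: block_def)

lemma block_nonempty: "j < k \<Longrightarrow> block j \<noteq> {}"
proof -
  assume "j < k"
  then have "j \<in> lab ` {1..n}" unfolding lab_image by simp
  then show ?thesis by (auto simp: block_def)
qed

lemma block_inj: "j < k \<Longrightarrow> block i = block j \<Longrightarrow> i = j"
proof -
  assume "j < k" and eq: "block i = block j"
  then obtain p where p: "p \<in> block j" using block_nonempty by blast
  then have "p \<in> block i" by (simp only: eq)
  with p show "i = j" by simp
qed

lemma set_blocks: "set blocks = block ` {..<k}"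
  by (simp add: blocks_def atLeast0LessThan)

lemma lab_less: "p \<in> {1..n} \<Longrightarrow> lab p < k"
  using lab_image by blast

lemma distinct_blocks: "distinct blocks"
  using block_inj by (auto simp: blocks_def distinct_map inj_on_def)

lemma partition_blocks: "partition_on {1..n} (set blocks)"
proof (rule partition_onI)
  show "\<Union> (set blocks) = {1..n}"
    using lab_less by (fastforce simp: set_blocks)
  show "disjnt P Q" if "P \<in> set blocks" "Q \<in> set blocks" "P \<noteq> Q" for P Q
    using that by (auto simp: set_blocks disjnt_def block_def)
  show "{} \<notin> set blocks"
    using block_nonempty by (auto simp: set_blocks)
qed

lemma precedes_blocks:
  assumes "i < k" "j < k"
  shows "precedes blocks (block i) (block j) \<longleftrightarrow> i < j"
proof
  assume "precedes blocks (block i) (block j)"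
  then obtain i' j' where "i' < j'" "j' < k" "block i' = block i" "block j' = block j"
    by (auto simp: precedes_def blocks_def)
  then show "i < j" using assms block_inj by blast
next
  assume "i < j"
  then show "precedes blocks (block i) (block j)"
    using assms unfolding precedes_def by (intro exI[of _ i] exI[of _ j]) (simp add: blocks_def)
qed

end

locale noncrossing_labelling = labelling +
  assumes nc: "i < p \<Longrightarrow> p < q \<Longrightarrow> q < r \<Longrightarrow> i \<in> {1..n} \<Longrightarrow> r \<in> {1..n} \<Longrightarrow>
    lab i = lab q \<Longrightarrow> lab p = lab r \<Longrightarrow> lab i = lab p"
begin

text \<open>Block \<open>j\<close> has been begun but not finished when position \<open>t\<close> is
  about to be read.\<close>

definition open_at :: "nat \<Rightarrow> nat \<Rightarrow> bool" where
  "open_at t j \<longleftrightarrow> (\<exists>p\<in>{1..n}. \<exists>q\<in>{1..n}. p < t \<and> t \<le> q \<and> lab p = j \<and> lab q = j)"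

context
  fixes t j
  assumes t: "t \<in> {1..n}" "lab t = j" and last: "\<And>q. q \<in> {1..n} \<Longrightarrow> t < q \<Longrightarrow> lab q \<noteq> j"
begin

text \<open>As \<open>t\<close> is the last position of block \<open>j\<close>, a cover has elements
  on both sides of \<open>t\<close>. Conversely, if \<open>p\<close> and \<open>q\<close> of block
  \<open>j'\<close> surround \<open>t\<close>, an element \<open>x < p\<close> of block
  \<open>j\<close> would give the crossing \<open>x < p < t < q\<close>.\<close>

lemma covers_last_iff:
  "covers (block j') (block j) \<longleftrightarrow> open_at (Suc t) j'"
proof
  assume "covers (block j') (block j)"
  then obtain p q where "p \<in> block j'" "q \<in> block j'" "\<forall>x\<in>block j. p < x \<and> x < q"
    by (auto simp: covers_def)
  moreover from this have "p < t" "t < q" using t by auto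
  ultimately show "open_at (Suc t) j'"
    unfolding open_at_def by (intro bexI[of _ p] bexI[of _ q]) auto
next
  assume "open_at (Suc t) j'"
  then obtain p q where pq: "p \<in> {1..n}" "q \<in> {1..n}" "p < Suc t" "Suc t \<le> q" "lab p = j'" "lab q = j'"
    unfolding open_at_def by blast
  have "j' \<noteq> j" using last[of q] pq by auto
  have "p < x \<and> x < q" if x: "x \<in> block j" for x
  proof -
    have "x \<le> t" using last[of x] x by (meson mem_block not_le)
    moreover have "\<not> x < p"
      using nc[of x p t q] pq x t \<open>j' \<noteq> j\<close> by (cases "p = t") auto
    ultimately show ?thesis using x pq \<open>j' \<noteq> j\<close> by (cases "x = p") auto
  qed
  then show "covers (block j') (block j)"
    using pq unfolding covers_def by (intro bexI[of _ p] bexI[of _ q]) auto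
qed

lemma outer_last: "block j \<in> outer_blocks blocks \<longleftrightarrow> (\<forall>j'. \<not> open_at (Suc t) j')"
proof -
  have "j' < k" if "open_at (Suc t) j'" for j'
    using that lab_less unfolding open_at_def by blast
  moreover have "j < k" using t lab_less by blast
  ultimately show ?thesis
    using covers_last_iff by (auto simp: outer_blocks_def inner_blocks_def set_blocks)
qed

text \<open>Open blocks are nested because crossings are excluded, and the one with the latest
  position up to \<open>t\<close>, here \<open>p\<close>, is innermost.\<close>

lemma nearest_cover_last:
  assumes "open_at (Suc t) j'" "p \<in> {1..n}" "p \<le> t" "lab p = j'"
    and top: "\<And>i p'. open_at (Suc t) i \<Longrightarrow> i \<noteq> j' \<Longrightarrow> p' \<in> {1..n} \<Longrightarrow> p' \<le> t \<Longrightarrow> lab p' = i \<Longrightarrow> p' < p"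
  shows "nearest_cover blocks (block j) = block j'"
  unfolding nearest_cover_def
proof (rule the_equality)
  have "j' < k" using assms(2,4) lab_less by blast
  have "\<not> covers (block j') (block i)" if i: "open_at (Suc t) i" for i
  proof
    assume "covers (block j') (block i)"
    then obtain x where x: "x \<in> block j'" "\<forall>y\<in>block i. x < y" by (auto simp: covers_def)
    obtain p' q' where p': "p' \<in> {1..n}" "q' \<in> {1..n}" "p' < Suc t" "Suc t \<le> q'" "lab p' = i" "lab q' = i"
      using i unfolding open_at_def by blast
    have "i \<noteq> j'" using x by auto
    then have "p' < p" using top[OF i] p' by auto
    then show False using nc[of x p' p q'] x p' assms(2-4) \<open>i \<noteq> j'\<close> by auto
  qed
  then show "block j' \<in> set blocks \<and> covers (block j') (block j) \<and>
      \<not> (\<exists>P'\<in>set blocks. covers P' (block j) \<and> covers (block j') P')"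
    using assms(1) \<open>j' < k\<close> covers_last_iff by (auto simp: set_blocks)
next
  fix Q assume Q: "Q \<in> set blocks \<and> covers Q (block j) \<and>
      \<not> (\<exists>P'\<in>set blocks. covers P' (block j) \<and> covers Q P')"
  then obtain i where i: "Q = block i" "i < k" by (auto simp: set_blocks)
  show "Q = block j'"
  proof (rule ccontr)
    assume "Q \<noteq> block j'"
    then have "i \<noteq> j'" using i by auto
    have "open_at (Suc t) i" using Q i covers_last_iff by auto
    moreover from this obtain p' q' where
      p': "p' \<in> {1..n}" "q' \<in> {1..n}" "p' < Suc t" "Suc t \<le> q'" "lab p' = i" "lab q' = i"
      unfolding open_at_def by blast
    ultimately have "p' < p" using top[of i p'] \<open>i \<noteq> j'\<close> by auto
    \<comment> \<open>Any other open block encloses \<open>block j'\<close>, so it is not a nearest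
      cover.\<close>
    have "p' < x \<and> x < q'" if x: "x \<in> block j'" for x
    proof -
      have "\<not> x < p'" using nc[of x p' p q'] x p' assms(2-4) \<open>p' < p\<close> \<open>i \<noteq> j'\<close> by auto
      moreover have "\<not> q' < x" using nc[of p' p q' x] x p' assms(2-4) \<open>p' < p\<close> \<open>i \<noteq> j'\<close> by auto
      moreover have "x \<noteq> p'" "x \<noteq> q'" using x p' \<open>i \<noteq> j'\<close> by auto
      ultimately show ?thesis by simp
    qed
    then have "covers (block i) (block j')"
      using p' unfolding covers_def by (intro bexI[of _ p'] bexI[of _ q']) auto
    moreover have "covers (block j') (block j)" using assms(1) covers_last_iff by simp
    moreover have "block j' \<in> set blocks" using assms(2,4) lab_less by (auto simp: set_blocks)
    ultimately show False using Q i by blast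
  qed
qed

end

text \<open>The open block with the latest position up to the last element of \<open>block j\<close>
  is the nearest cover. This makes every inner block fall into \<open>B_blocks\<close> or
  \<open>C_blocks\<close>.\<close>

lemma nearest_cover_cases:
  assumes "j < k"
  shows "block j \<in> outer_blocks blocks \<or>
    (\<exists>j'<k. j' \<noteq> j \<and> nearest_cover blocks (block j) = block j')"
proof (cases "block j \<in> outer_blocks blocks")
  case False
  define t where "t = Max (block j)"
  have fin: "finite (block j)" by (simp add: block_def)
  then have "t \<in> block j" unfolding t_def using block_nonempty[OF assms] by (rule Max_in)
  then have t: "t \<in> {1..n}" "lab t = j" by auto
  have last: "lab q \<noteq> j" if "q \<in> {1..n}" "t < q" for q
    using that Max_ge[OF fin, of q] by (auto simp: t_def)
  define S where "S = {p \<in> {1..n}. p \<le> t \<and> open_at (Suc t) (lab p)}"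
  have S: "finite S" by (simp add: S_def)
  obtain i where "open_at (Suc t) i" using False outer_last[OF t last] by auto
  moreover from this obtain x where "x \<in> {1..n}" "x < Suc t" "lab x = i"
    unfolding open_at_def by blast
  ultimately have "x \<in> S" by (simp add: S_def)
  then have "S \<noteq> {}" by blast
  define p where "p = Max S"
  have p: "p \<in> S" unfolding p_def using S \<open>S \<noteq> {}\<close> by (rule Max_in)
  have "nearest_cover blocks (block j) = block (lab p)"
  proof (rule nearest_cover_last[OF t last])
    fix i p' assume *: "open_at (Suc t) i" "i \<noteq> lab p" "p' \<in> {1..n}" "p' \<le> t" "lab p' = i"
    then have "p' \<le> p" unfolding p_def by (intro Max_ge[OF S]) (auto simp: S_def)
    then show "p' < p" using * by (cases "p' = p") auto
  qed (use p in \<open>auto simp: S_def\<close>)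
  moreover have "lab p \<noteq> j" using p last by (auto simp: S_def open_at_def)
  moreover have "lab p < k" using p lab_less by (auto simp: S_def)
  ultimately show ?thesis by blast
qed simp

lemma B_blocks_iff:
  assumes "j < k" "j' < k" "nearest_cover blocks (block j) = block j'"
    "block j \<notin> outer_blocks blocks"
  shows "block j \<in> B_blocks blocks \<longleftrightarrow> j' < j" "block j \<in> C_blocks blocks \<longleftrightarrow> j < j'"
proof -
  have "block j \<in> inner_blocks blocks"
    using assms(1,4) by (simp add: outer_blocks_def set_blocks)
  then show "block j \<in> B_blocks blocks \<longleftrightarrow> j' < j" "block j \<in> C_blocks blocks \<longleftrightarrow> j < j'"
    using precedes_blocks assms(1,2) by (simp_all add: B_blocks_def C_blocks_def assms(3))
qed

lemma blocks_classes:
  "set blocks = outer_blocks blocks \<union> B_blocks blocks \<union> C_blocks blocks"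
  "outer_blocks blocks \<inter> B_blocks blocks = {}" "outer_blocks blocks \<inter> C_blocks blocks = {}"
  "B_blocks blocks \<inter> C_blocks blocks = {}"
proof -
  show "outer_blocks blocks \<inter> B_blocks blocks = {}" "outer_blocks blocks \<inter> C_blocks blocks = {}"
    by (auto simp: B_blocks_def C_blocks_def outer_blocks_def)
  have sub: "B_blocks blocks \<subseteq> set blocks" "C_blocks blocks \<subseteq> set blocks"
    "outer_blocks blocks \<subseteq> set blocks"
    by (auto simp: B_blocks_def C_blocks_def outer_blocks_def inner_blocks_def)
  have cases: "P \<in> outer_blocks blocks \<or> (P \<in> B_blocks blocks \<longleftrightarrow> P \<notin> C_blocks blocks)"
    if P: "P \<in> set blocks" for P
  proof -
    obtain j where "P = block j" "j < k" using P by (auto simp: set_blocks)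
    then show ?thesis using nearest_cover_cases[of j] B_blocks_iff[of j] by (metis linorder_neq_iff not_less_iff_gr_or_eq)
  qed
  then show "set blocks = outer_blocks blocks \<union> B_blocks blocks \<union> C_blocks blocks"
    using sub by blast
  show "B_blocks blocks \<inter> C_blocks blocks = {}"
    using cases sub \<open>outer_blocks blocks \<inter> B_blocks blocks = {}\<close> by blast
qed

end

section \<open>Noncrossing words\<close>

locale labelled_run = functional_pair \<psi> \<theta> + noncrossing_labelling n k lab
  for \<psi> \<theta> :: "'a::complex_algebra_1 \<Rightarrow> complex" and n k lab +
  fixes a :: "nat \<Rightarrow> 'a" and \<chi> :: "'a \<Rightarrow> complex"
begin

definition remaining :: "nat \<Rightarrow> (nat \<times> 'a) list" where
  "remaining t = map (\<lambda>p. (lab p, a p)) [t..<Suc n]"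

definition letters :: "nat \<Rightarrow> nat \<Rightarrow> 'a list" where
  "letters t j = map a (filter (\<lambda>p. lab p = j) [1..<t])"

text \<open>Block \<open>i\<close> was visited more recently than block \<open>j\<close>, expressed
  without naming last positions. For open blocks this means lying further inside.\<close>

definition above :: "nat \<Rightarrow> nat \<Rightarrow> nat \<Rightarrow> bool" where
  "above t i j \<longleftrightarrow>
     (\<forall>p'\<in>{1..n}. p' < t \<longrightarrow> lab p' = j \<longrightarrow> (\<exists>p\<in>{1..n}. p' < p \<and> p < t \<and> lab p = i))"

text \<open>The only stack that can contribute once the positions below \<open>t\<close> have been read:
  the blocks that are still open, innermost first.\<close>

definition stack_at :: "nat \<Rightarrow> (nat \<times> 'a list) list \<Rightarrow> bool" where
  "stack_at t s \<longleftrightarrow> distinct (map fst s) \<and> (\<forall>(j, ws)\<in>set s. ws = letters t j) \<and>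
     fst ` set s = Collect (open_at t) \<and> sorted_wrt (above t) (map fst s)"

text \<open>The functional whose cumulant is the weight of block \<open>j\<close>; the last case is
  that of \<open>C_blocks\<close>, by \<open>blocks_classes\<close>.\<close>

definition status :: "nat \<Rightarrow> 'a \<Rightarrow> complex" where
  "status j = (if block j \<in> outer_blocks blocks then \<chi>
     else if block j \<in> B_blocks blocks then \<psi> else \<theta>)"

lemma letters_Suc:
  "1 \<le> t \<Longrightarrow> letters (Suc t) j = letters t j @ (if lab t = j then [a t] else [])"
  by (simp add: letters_def)

lemma letters_final:
  assumes "t \<in> {1..n}" "j \<notin> lab ` {Suc t..n}"
  shows "letters (Suc n) j = letters (Suc t) j"
proof -
  have "[1..<Suc n] = [1..<Suc t] @ [Suc t..<Suc n]"
    using assms(1) upt_add_eq_append[of 1 "Suc t" "n - t"] by (simp del: upt_Suc)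
  moreover have "filter (\<lambda>p. lab p = j) [Suc t..<Suc n] = []"
    using assms(2) by (auto simp: filter_empty_conv simp del: upt_Suc)
  ultimately show ?thesis by (simp add: letters_def del: upt_Suc)
qed

lemma letters_restrict: "letters (Suc n) j = restrict_tuple a (block j)"
proof -
  have "block j = set (filter (\<lambda>p. lab p = j) [1..<Suc n])"
    by (auto simp: block_def simp del: upt_Suc)
  moreover have "sorted_list_of_set (set (filter (\<lambda>p. lab p = j) [1..<Suc n])) =
      filter (\<lambda>p. lab p = j) [1..<Suc n]"
    by (intro sorted_list_of_set.idem_if_sorted_distinct)
      (simp_all add: sorted_wrt_filter del: upt_Suc)
  ultimately show ?thesis by (simp add: letters_def restrict_tuple_def del: upt_Suc)
qed

lemma set_remaining: "fst ` set (remaining t) = lab ` {t..n}"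
  by (force simp: remaining_def simp del: upt_Suc)

lemma remaining_Cons: "t \<le> n \<Longrightarrow> remaining t = (lab t, a t) # remaining (Suc t)"
  by (simp add: remaining_def upt_conv_Cons del: upt_Suc)

lemma open_at_Suc:
  assumes "t \<in> {1..n}"
  shows "open_at (Suc t) i \<longleftrightarrow> (if i = lab t then lab t \<in> lab ` {Suc t..n} else open_at t i)"
proof (cases "i = lab t")
  case True
  have "open_at (Suc t) (lab t) \<longleftrightarrow> lab t \<in> lab ` {Suc t..n}"
  proof
    assume "open_at (Suc t) (lab t)"
    then obtain q where "q \<in> {1..n}" "Suc t \<le> q" "lab q = lab t"
      unfolding open_at_def by blast
    then show "lab t \<in> lab ` {Suc t..n}" by (intro image_eqI[of _ _ q]) auto
  next
    assume "lab t \<in> lab ` {Suc t..n}"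
    then obtain q where "lab t = lab q" "q \<in> {Suc t..n}" by (rule imageE)
    then show "open_at (Suc t) (lab t)"
      using assms unfolding open_at_def by (intro bexI[of _ t] bexI[of _ q]) auto
  qed
  then show ?thesis using True by simp
next
  case False
  have "open_at t i" if "open_at (Suc t) i"
  proof -
    obtain p q where "p \<in> {1..n}" "q \<in> {1..n}" "p < Suc t" "Suc t \<le> q" "lab p = i" "lab q = i"
      using \<open>open_at (Suc t) i\<close> unfolding open_at_def by blast
    with False show ?thesis
      unfolding open_at_def by (intro bexI[of _ p] bexI[of _ q]) (auto simp: less_Suc_eq)
  qed
  moreover have "open_at (Suc t) i" if "open_at t i"
  proof -
    obtain p q where "p \<in> {1..n}" "q \<in> {1..n}" "p < t" "t \<le> q" "lab p = i" "lab q = i"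
      using \<open>open_at t i\<close> unfolding open_at_def by blast
    with False show ?thesis
      unfolding open_at_def by (intro bexI[of _ p] bexI[of _ q]) (auto simp: le_less)
  qed
  ultimately show ?thesis using False by auto
qed

text \<open>Once block \<open>j\<close> is closed, the top of the stack is the open block visited
  last, which is its nearest cover. Comparing labels means comparing places in the ordered
  partition, so the case of \<psi> in \<open>pick\<close> is that of
  \<open>B_blocks\<close>.\<close>

lemma pick_status:
  assumes t: "t \<in> {1..n}" "j = lab t" "j \<notin> lab ` {Suc t..n}" and s: "stack_at (Suc t) s"
  shows "pick \<chi> \<psi> \<theta> s j = status j"
proof -
  have last: "lab q \<noteq> j" if "q \<in> {1..n}" "t < q" for q
    using t(3) that by (auto simp: image_iff)
  have j: "j < k" using t lab_less by blast
  have outer: "block j \<in> outer_blocks blocks \<longleftrightarrow> fst ` set s = {}"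
    using outer_last[OF t(1) t(2)[symmetric] last] s by (auto simp: stack_at_def)
  show ?thesis
  proof (cases s)
    case Nil
    then show ?thesis using outer by (simp add: status_def)
  next
    case (Cons x s')
    obtain j' ws where x: "x = (j', ws)" by force
    have j': "open_at (Suc t) j'" using s Cons x by (auto simp: stack_at_def)
    define S where "S = {p \<in> {1..n}. p \<le> t \<and> lab p = j'}"
    have S: "finite S" by (simp add: S_def)
    obtain x where "x \<in> {1..n}" "x < Suc t" "lab x = j'"
      using j' unfolding open_at_def by blast
    then have "x \<in> S" by (simp add: S_def)
    define m where "m = Max S"
    have "m \<in> S" unfolding m_def using S \<open>x \<in> S\<close> by (intro Max_in) auto
    then have p: "m \<in> {1..n}" "m \<le> t" "lab m = j'" by (auto simp: S_def)
    then have "j' < k" using lab_less by blast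
    have "nearest_cover blocks (block j) = block j'"
    proof (rule nearest_cover_last[OF t(1) t(2)[symmetric] last j'])
      fix i p' assume *: "open_at (Suc t) i" "i \<noteq> j'" "p' \<in> {1..n}" "p' \<le> t" "lab p' = i"
      then have "i \<in> fst ` set s'" using s Cons x by (auto simp: stack_at_def)
      then have "above (Suc t) j' i" using s Cons x by (auto simp: stack_at_def)
      then obtain y where y: "y \<in> {1..n}" "p' < y" "y < Suc t" "lab y = j'"
        using * unfolding above_def by (metis le_imp_less_Suc)
      then have "y \<le> m" unfolding m_def by (intro Max_ge[OF S]) (auto simp: S_def)
      then show "p' < m" using y by simp
    qed (use p in auto)
    moreover have "block j \<notin> outer_blocks blocks" using outer Cons by simp
    ultimately show ?thesis
      using B_blocks_iff(1)[OF j \<open>j' < k\<close>] by (simp add: status_def Cons x)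
  qed
qed

text \<open>Here \<open>s'\<close> is the stack without the block of \<open>t\<close>. The invariant
  passes to the branch that keeps this block if it continues, and to the branch that evaluates it if
  \<open>t\<close> is its last position.\<close>

lemma stack_step:
  assumes t: "t \<in> {1..n}" and s: "stack_at t s"
  obtains s' where
    "linear_run \<chi> (remaining t) s =
       linear_run \<chi> (remaining (Suc t)) ((lab t, letters (Suc t) (lab t)) # s') +
       (if lab t \<in> lab ` {Suc t..n} then 0
        else cumulant (pick \<chi> \<psi> \<theta> s' (lab t)) (letters (Suc t) (lab t)) *
          linear_run \<chi> (remaining (Suc t)) s')"
    "lab t \<in> lab ` {Suc t..n} \<Longrightarrow> stack_at (Suc t) ((lab t, letters (Suc t) (lab t)) # s')"
    "lab t \<notin> lab ` {Suc t..n} \<Longrightarrow> stack_at (Suc t) s'"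
proof -
  define j where "j = lab t"
  have rem: "remaining t = (j, a t) # remaining (Suc t)"
    using t by (simp add: remaining_Cons j_def)
  have letters: "letters (Suc t) j = letters t j @ [a t]"
    using t by (simp add: letters_Suc j_def)
  have s_def: "distinct (map fst s)" "\<And>i ws. (i, ws) \<in> set s \<Longrightarrow> ws = letters t i"
    "fst ` set s = Collect (open_at t)" "sorted_wrt (above t) (map fst s)"
    using s by (auto simp: stack_at_def)
  \<comment> \<open>Either the block of \<open>t\<close> is open and then on top, or it begins at
    \<open>t\<close> and none of its letters has been read.\<close>
  obtain s' where s': "s = (j, letters t j) # s' \<or> s = s' \<and> letters t j = []" "j \<notin> fst ` set s'"
  proof (cases "open_at t j")
    case True
    then have "j \<in> fst ` set s" by (simp add: s_def(3))
    then obtain s1 ws s2 where split: "s = s1 @ (j, ws) # s2"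
      by (metis (no_types, lifting) imageE prod.collapse split_list)
    \<comment> \<open>An entry above \<open>j\<close> would have been visited at some
      \<open>y\<close> after \<open>p\<close> and would still be open at \<open>t\<close>, so
      \<open>p < y < t < q\<close> would be a crossing.\<close>
    have "s1 = []"
    proof (rule ccontr)
      assume "s1 \<noteq> []"
      then obtain x s1' where x: "s1 = x # s1'" by (cases s1) auto
      have "fst x \<noteq> j" using s_def(1) split x by auto
      obtain p where p: "p \<in> {1..n}" "p < t" "lab p = j"
        using True unfolding open_at_def by blast
      have "above t (fst x) j" using s_def(4) split x by (auto simp: sorted_wrt_append)
      then obtain y where y: "y \<in> {1..n}" "p < y" "y < t" "lab y = fst x"
        using p unfolding above_def by blast
      have "open_at t (fst x)" using s_def(3) split x by auto
      then obtain q where "q \<in> {1..n}" "t \<le> q" "lab q = fst x"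
        unfolding open_at_def by blast
      then show False
        using nc[of p y t q] p y \<open>fst x \<noteq> j\<close> by (cases "q = t") (auto simp: j_def)
    qed
    then have "s = (j, letters t j) # s2" "j \<notin> fst ` set s2"
      using split s_def(1,2) by auto
    then show ?thesis using that by blast
  next
    case False
    have "lab p \<noteq> j" if "p \<in> {1..<t}" for p
    proof
      assume "lab p = j"
      then have "open_at t j"
        using t \<open>p \<in> {1..<t}\<close> unfolding open_at_def
        by (intro bexI[of _ p] bexI[of _ t]) (auto simp: j_def)
      then show False using False by simp
    qed
    then have "letters t j = []" by (auto simp: letters_def filter_empty_conv)
    moreover have "j \<notin> fst ` set s" using False by (simp add: s_def(3))
    ultimately show ?thesis using that by blast
  qed
  have step: "linear_run \<chi> (remaining t) s =
      linear_run \<chi> (remaining (Suc t)) ((j, letters (Suc t) j) # s') +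
      (if j \<in> lab ` {Suc t..n} then 0
       else cumulant (pick \<chi> \<psi> \<theta> s' j) (letters (Suc t) j) *
         linear_run \<chi> (remaining (Suc t)) s')"
  proof (cases "s = (j, letters t j) # s'")
    case True
    then show ?thesis
      using s'(2) unfolding rem True linear_run_top by (simp add: set_remaining letters)
  next
    case False
    then have "s = s'" "letters t j = []" using s'(1) by auto
    moreover have "fresh j s'" using s'(2) by (cases s') auto
    ultimately show ?thesis
      using s'(2) unfolding rem by (simp add: linear_run_fresh set_remaining letters)
  qed
  have labels: "fst ` set s' = {i. open_at t i \<and> i \<noteq> j}"
  proof -
    define A where "A = fst ` set s'"
    have "Collect (open_at t) = insert j A \<or> Collect (open_at t) = A"
      using s'(1) unfolding s_def(3)[symmetric] A_def by auto
    moreover have "j \<notin> A" using s'(2) by (simp add: A_def)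
    ultimately have "A = {i. open_at t i \<and> i \<noteq> j}" by blast
    then show ?thesis by (simp add: A_def)
  qed
  have ne: "i \<noteq> j" if "i \<in> fst ` set s'" for i
    using that s'(2) by blast
  have above_Suc: "above (Suc t) i i'" if "i' \<noteq> j" "above t i i'" for i i'
    using that unfolding above_def j_def by (metis less_Suc_eq)
  have above_top: "above (Suc t) j i" if "i \<noteq> j" for i
    using that t unfolding above_def j_def by (metis less_Suc_eq)
  have letters': "\<forall>(i, ws)\<in>set s'. ws = letters (Suc t) i"
  proof clarify
    fix i ws assume *: "(i, ws) \<in> set s'"
    then have "(i, ws) \<in> set s" using s'(1) by auto
    moreover have "lab t \<noteq> i" using ne[of i] * j_def by force
    ultimately show "ws = letters (Suc t) i"
      using s_def(2)[of i ws] t by (simp add: letters_Suc)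
  qed
  have distinct': "distinct (map fst s')" and "sorted_wrt (above t) (map fst s')"
    using s'(1) s_def(1,4) by auto
  from this(2) have sorted': "sorted_wrt (above (Suc t)) (map fst s')"
    by (rule sorted_wrt_mono_rel[rotated]) (use above_Suc ne in auto)
  show ?thesis
  proof (rule that)
    show "stack_at (Suc t) ((lab t, letters (Suc t) (lab t)) # s')" if *: "lab t \<in> lab ` {Suc t..n}"
    proof -
      have "x \<in> insert j (fst ` set s') \<longleftrightarrow> open_at (Suc t) x" for x
        unfolding labels open_at_Suc[OF t] j_def[symmetric] using * by (cases "x = j") (simp_all add: j_def)
      then have "insert j (fst ` set s') = Collect (open_at (Suc t))" by blast
      then show ?thesis
        using letters' distinct' sorted' above_top ne s'(2)
        unfolding stack_at_def j_def[symmetric] by simp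
    qed
    show "stack_at (Suc t) s'" if *: "lab t \<notin> lab ` {Suc t..n}"
    proof -
      have "x \<in> fst ` set s' \<longleftrightarrow> open_at (Suc t) x" for x
        unfolding labels open_at_Suc[OF t] j_def[symmetric] using * by (cases "x = j") (simp_all add: j_def)
      then have "fst ` set s' = Collect (open_at (Suc t))" by blast
      then show ?thesis
        using letters' distinct' sorted' unfolding stack_at_def by simp
    qed
  qed (rule step[unfolded j_def])
qed

text \<open>Downward induction on \<open>t\<close>, with the product over the labels still to be
  read. While a block continues, its evaluation has weight \<open>0\<close>; at its last position
  the branch that keeps it dies by \<open>linear_run_unclosed\<close>. So one branch survives at
  each step.\<close>

lemma linear_run_noncrossing:
  "linear_run \<chi> (remaining 1) [] = (\<Prod>j\<in>lab ` {1..n}. cumulant (status j) (restrict_tuple a (block j)))"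
proof -
  have "1 \<le> Suc n" by simp
  then have "\<forall>s. stack_at 1 s \<longrightarrow> linear_run \<chi> (remaining 1) s =
      (\<Prod>j\<in>lab ` {1..n}. cumulant (status j) (letters (Suc n) j))"
  proof (induction rule: inc_induct)
    case base
    have nil: "s = []" if "stack_at (Suc n) s" for s
    proof -
      have "fst ` set s = Collect (open_at (Suc n))" using that by (simp add: stack_at_def)
      also have "\<dots> = {}" by (auto simp: open_at_def)
      finally show ?thesis by simp
    qed
    show ?case by (auto simp: remaining_def null_stack_def dest: nil)
  next
    case (step t)
    have t: "t \<in> {1..n}" using step by simp
    have image: "lab ` {t..n} = insert (lab t) (lab ` {Suc t..n})"
      using t by (subst atLeastAtMost_insertL[symmetric]) auto
    show ?case
    proof (intro allI impI)
      fix s assume s: "stack_at t s"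
      show "linear_run \<chi> (remaining t) s = (\<Prod>j\<in>lab ` {t..n}. cumulant (status j) (letters (Suc n) j))"
      proof (rule stack_step[OF t s])
        fix s'
        assume *: "linear_run \<chi> (remaining t) s =
            linear_run \<chi> (remaining (Suc t)) ((lab t, letters (Suc t) (lab t)) # s') +
            (if lab t \<in> lab ` {Suc t..n} then 0
             else cumulant (pick \<chi> \<psi> \<theta> s' (lab t)) (letters (Suc t) (lab t)) *
               linear_run \<chi> (remaining (Suc t)) s')"
          and cont: "lab t \<in> lab ` {Suc t..n} \<Longrightarrow>
            stack_at (Suc t) ((lab t, letters (Suc t) (lab t)) # s')"
          and close: "lab t \<notin> lab ` {Suc t..n} \<Longrightarrow> stack_at (Suc t) s'"
        show ?thesis
        proof (cases "lab t \<in> lab ` {Suc t..n}")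
          case True
          then have "lab ` {t..n} = lab ` {Suc t..n}"
            unfolding image by (rule insert_absorb)
          moreover have "linear_run \<chi> (remaining t) s =
              linear_run \<chi> (remaining (Suc t)) ((lab t, letters (Suc t) (lab t)) # s')"
            unfolding * using True by (simp only: if_True add_0_right)
          ultimately show ?thesis using cont[OF True] step.IH by metis
        next
          case False
          have "linear_run \<chi> (remaining (Suc t)) ((lab t, letters (Suc t) (lab t)) # s') = 0"
            using False by (intro linear_run_unclosed) (auto simp: set_remaining)
          then have "linear_run \<chi> (remaining t) s =
              cumulant (status (lab t)) (letters (Suc n) (lab t)) * linear_run \<chi> (remaining (Suc t)) s'"
            unfolding * pick_status[OF t refl False close[OF False]] letters_final[OF t False]
            using False by (simp only: if_False add_0_left)
          also have "linear_run \<chi> (remaining (Suc t)) s' =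
              (\<Prod>j\<in>lab ` {Suc t..n}. cumulant (status j) (letters (Suc n) j))"
            using close[OF False] step.IH by blast
          also have "cumulant (status (lab t)) (letters (Suc n) (lab t)) * \<dots> =
              (\<Prod>j\<in>lab ` {t..n}. cumulant (status j) (letters (Suc n) j))"
            unfolding image by (subst prod.insert) (use False in simp_all)
          finally show ?thesis .
        qed
      qed
    qed
  qed
  moreover have "stack_at 1 []" by (auto simp: stack_at_def open_at_def)
  ultimately show ?thesis by (simp add: letters_restrict)
qed

end

section \<open>Weights of ordered noncrossing partitions\<close>

context functional_pair
begin

definition block_weight :: "('a \<Rightarrow> complex) \<Rightarrow> (nat \<Rightarrow> 'a) \<Rightarrow> nat set list \<Rightarrow> complex" where
  "block_weight \<chi> a \<pi> =
     (\<Prod>P\<in>outer_blocks \<pi>. cumulant \<chi> (restrict_tuple a P)) *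
     (\<Prod>P\<in>B_blocks \<pi>. cumulant \<psi> (restrict_tuple a P)) *
     (\<Prod>P\<in>C_blocks \<pi>. cumulant \<theta> (restrict_tuple a P))"

end

context labelled_run
begin

lemma linear_run_block_weight: "linear_run \<chi> (remaining 1) [] = block_weight \<chi> a blocks"
proof -
  define f where "f P = cumulant (if P \<in> outer_blocks blocks then \<chi>
     else if P \<in> B_blocks blocks then \<psi> else \<theta>) (restrict_tuple a P)" for P
  have "linear_run \<chi> (remaining 1) [] = (\<Prod>j<k. f (block j))"
    unfolding linear_run_noncrossing lab_image status_def f_def ..
  also have "\<dots> = (\<Prod>P\<in>set blocks. f P)"
    unfolding set_blocks using block_inj by (subst prod.reindex) (auto simp: inj_on_def)
  also have "\<dots> = (\<Prod>P\<in>outer_blocks blocks. f P) * (\<Prod>P\<in>B_blocks blocks. f P) *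
      (\<Prod>P\<in>C_blocks blocks. f P)"
  proof -
    have fin: "finite (outer_blocks blocks)" "finite (B_blocks blocks)" "finite (C_blocks blocks)"
      using blocks_classes(1) by (metis finite_Un List.finite_set)+
    show ?thesis
      unfolding blocks_classes(1) using fin blocks_classes(2-4)
      by (subst prod.union_disjoint; simp add: Int_Un_distrib2)+
  qed
  also have "\<dots> = block_weight \<chi> a blocks"
  proof -
    have "(\<Prod>P\<in>outer_blocks blocks. f P) =
        (\<Prod>P\<in>outer_blocks blocks. cumulant \<chi> (restrict_tuple a P))"
      by (rule prod.cong) (auto simp: f_def)
    moreover have "(\<Prod>P\<in>B_blocks blocks. f P) =
        (\<Prod>P\<in>B_blocks blocks. cumulant \<psi> (restrict_tuple a P))"
      using blocks_classes(2) by (intro prod.cong) (auto simp: f_def)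
    moreover have "(\<Prod>P\<in>C_blocks blocks. f P) =
        (\<Prod>P\<in>C_blocks blocks. cumulant \<theta> (restrict_tuple a P))"
      using blocks_classes(3,4) by (intro prod.cong) (auto simp: f_def)
    ultimately show ?thesis by (simp add: block_weight_def)
  qed
  finally show ?thesis .
qed

end

section \<open>Ordered partitions as labellings\<close>

lemma upt_split: "l \<le> m \<Longrightarrow> m < h \<Longrightarrow> [l..<h] = [l..<m] @ m # [Suc m..<h]"
  using upt_add_eq_append[of l m "h - m"] by (simp add: upt_conv_Cons)

lemma noncrossingD:
  assumes "noncrossing S" "B \<in> S" "B' \<in> S" "i \<in> B" "q \<in> B" "p \<in> B'" "r \<in> B'"
    "i < p" "p < q" "q < r"
  shows "B = B'"
proof (rule ccontr)
  assume "B \<noteq> B'"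
  moreover have "\<exists>i\<in>B. \<exists>j\<in>B. \<exists>k\<in>B'. \<exists>l\<in>B'. i < k \<and> k < j \<and> j < l"
    by (intro bexI[of _ i] bexI[of _ q] bexI[of _ p] bexI[of _ r] conjI assms)
  ultimately have "\<exists>B\<in>S. \<exists>B'\<in>S. B \<noteq> B' \<and>
      (\<exists>i\<in>B. \<exists>j\<in>B. \<exists>k\<in>B'. \<exists>l\<in>B'. i < k \<and> k < j \<and> j < l)"
    by (intro bexI[of _ B] bexI[of _ B'] conjI assms(2,3))
  then show False using assms(1) by (simp add: noncrossing_def)
qed

context labelling
begin

lemma noncrossing_labellingI:
  assumes "noncrossing (set blocks)"
  shows "noncrossing_labelling n k lab"
proof
  fix i p q r
  assume *: "i < p" "p < q" "q < r" "i \<in> {1..n}" "r \<in> {1..n}" "lab i = lab q" "lab p = lab r"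
  show "lab i = lab p"
  proof (rule ccontr)
    assume "lab i \<noteq> lab p"
    have p: "p \<in> {1..n}" and q: "q \<in> {1..n}" using * by auto
    have "block (lab i) = block (lab p)"
    proof (rule noncrossingD[OF assms, of _ _ i q p r])
      show "block (lab i) \<in> set blocks" "block (lab p) \<in> set blocks"
        using lab_less[OF p] lab_less[OF *(4)] unfolding set_blocks by blast+
    qed (use p q * in simp_all)
    then show False
      using block_inj[of "lab p" "lab i"] lab_less[OF p] \<open>lab i \<noteq> lab p\<close> by blast
  qed
qed

lemma crossing_positions:
  assumes "\<not> noncrossing (set blocks)"
  obtains i p q r where "i < p" "p < q" "q < r" "1 \<le> i" "r \<le> n" "lab i = lab q" "lab p = lab r"
    "lab i \<noteq> lab p"
proof -
  obtain B B' i p q r where "B \<in> set blocks" "B' \<in> set blocks" "B \<noteq> B'" "i \<in> B" "q \<in> B"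
    "p \<in> B'" "r \<in> B'" "i < p" "p < q" "q < r"
    using assms unfolding noncrossing_def by blast
  moreover from this obtain j j' where "B = block j" "B' = block j'"
    by (auto simp: set_blocks)
  ultimately show ?thesis using that[of i p q r] by auto
qed

end

context functional_pair
begin

lemma linear_run_crossing_labelling:
  assumes "labelling n k lab" "\<not> noncrossing (set (labelling.blocks n k lab))"
  shows "linear_run \<chi> (map (\<lambda>p. (lab p, a p)) [1..<Suc n]) [] = 0"
proof -
  obtain i p q r where *: "i < p" "p < q" "q < r" "1 \<le> i" "r \<le> n" "lab i = lab q" "lab p = lab r"
    "lab i \<noteq> lab p"
    using labelling.crossing_positions[OF assms] by blast
  \<comment> \<open>Three of the crossing positions are cut out of the word; the fourth,
    \<open>r\<close>, enters as an occurrence of its label in the rest.\<close>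
  have "[1..<Suc n] = [1..<i] @ i # [Suc i..<p] @ p # [Suc p..<q] @ q # [Suc q..<Suc n]"
    using * upt_split[of 1 i "Suc n"] upt_split[of "Suc i" p "Suc n"] upt_split[of "Suc p" q "Suc n"]
    by (simp del: upt_Suc)
  moreover have "lab p \<in> fst ` set (map (\<lambda>p. (lab p, a p)) [Suc q..<Suc n])"
    using * by (auto simp: image_image simp del: upt_Suc intro!: image_eqI[of _ _ r])
  ultimately show ?thesis
    using * by (simp add: linear_run_crossing del: upt_Suc)
qed

end

text \<open>List entries beyond the length of \<open>\<pi>\<close> are unspecified;
  \<open>LEAST\<close> is insensitive to them when \<open>p\<close> lies in some block of the
  list.\<close>

definition label_of :: "nat set list \<Rightarrow> nat \<Rightarrow> nat" where
  "label_of \<pi> p = (LEAST j. p \<in> \<pi> ! j)"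

lemma label_of_blocks:
  assumes "labelling n k lab" "p \<in> {1..n}"
  shows "label_of (labelling.blocks n k lab) p = lab p"
proof -
  interpret labelling n k lab by fact
  have nth: "blocks ! j = block j" if "j < k" for j
    using that by (simp add: blocks_def)
  have less: "lab p < k" using assms(2) by (rule lab_less)
  show ?thesis
    unfolding label_of_def
  proof (rule Least_equality)
    show "p \<in> blocks ! lab p" using assms(2) nth[OF less] by simp
  next
    fix j assume "p \<in> blocks ! j"
    then show "lab p \<le> j" using nth[of j] less by (cases "j < k") auto
  qed
qed

definition ordered_partitions :: "nat \<Rightarrow> nat set list set" where
  "ordered_partitions n = {\<pi>. distinct \<pi> \<and> partition_on {1..n} (set \<pi>)}"

lemma label_of_ordered_partition:
  assumes "\<pi> \<in> ordered_partitions n"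
  shows "p \<in> {1..n} \<Longrightarrow> label_of \<pi> p < length \<pi>"
    and "j < length \<pi> \<Longrightarrow> p \<in> \<pi> ! j \<longleftrightarrow> p \<in> {1..n} \<and> label_of \<pi> p = j"
proof -
  have \<pi>: "distinct \<pi>" "\<Union> (set \<pi>) = {1..n}" "disjoint (set \<pi>)"
    using assms by (auto simp: ordered_partitions_def partition_on_def)
  have *: "label_of \<pi> p < length \<pi> \<and> p \<in> \<pi> ! label_of \<pi> p" if p: "p \<in> {1..n}" for p
  proof -
    obtain B where "B \<in> set \<pi>" "p \<in> B" using p \<pi>(2) by blast
    then obtain i where "i < length \<pi>" "p \<in> \<pi> ! i" by (auto simp: in_set_conv_nth)
    then show ?thesis
      unfolding label_of_def by (meson LeastI Least_le le_less_trans)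
  qed
  then show "p \<in> {1..n} \<Longrightarrow> label_of \<pi> p < length \<pi>" by blast
  assume j: "j < length \<pi>"
  show "p \<in> \<pi> ! j \<longleftrightarrow> p \<in> {1..n} \<and> label_of \<pi> p = j"
  proof
    assume p: "p \<in> \<pi> ! j"
    then have n: "p \<in> {1..n}" using j \<pi>(2) nth_mem by blast
    have "\<pi> ! label_of \<pi> p = \<pi> ! j"
      using *[OF n] p j disjointD[OF \<pi>(3), of "\<pi> ! label_of \<pi> p" "\<pi> ! j"] by auto
    then have "label_of \<pi> p = j" using *[OF n] j \<pi>(1) by (simp add: nth_eq_iff_index_eq)
    with n show "p \<in> {1..n} \<and> label_of \<pi> p = j" by simp
  next
    assume "p \<in> {1..n} \<and> label_of \<pi> p = j"
    then show "p \<in> \<pi> ! j" using *[of p] by auto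
  qed
qed

lemma labelling_label_of:
  assumes "\<pi> \<in> ordered_partitions n"
  shows "labelling n (length \<pi>) (label_of \<pi>)"
proof
  have "j \<in> label_of \<pi> ` {1..n}" if j: "j < length \<pi>" for j
  proof -
    have "{} \<notin> set \<pi>"
      using assms by (auto simp: ordered_partitions_def partition_on_def)
    then have "\<pi> ! j \<noteq> {}" using nth_mem[OF j] by metis
    then obtain p where "p \<in> \<pi> ! j" by blast
    then show ?thesis using label_of_ordered_partition(2)[OF assms j, of p] by blast
  qed
  then show "label_of \<pi> ` {1..n} = {..<length \<pi>}"
    using label_of_ordered_partition(1)[OF assms] by blast
qed

lemma blocks_label_of:
  assumes "\<pi> \<in> ordered_partitions n"
  shows "labelling.blocks n (length \<pi>) (label_of \<pi>) = \<pi>"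
proof -
  interpret labelling n "length \<pi>" "label_of \<pi>" using assms by (rule labelling_label_of)
  have "block j = \<pi> ! j" if "j < length \<pi>" for j
    by (intro set_eqI) (simp only: mem_block label_of_ordered_partition(2)[OF assms that])
  then show ?thesis by (intro nth_equalityI) (simp_all add: blocks_def)
qed

lemma blocks_cong:
  assumes "labelling n k lab" "labelling n k lab'" "\<And>p. p \<in> {1..n} \<Longrightarrow> lab p = lab' p"
  shows "labelling.blocks n k lab = labelling.blocks n k lab'"
  using assms(3) by (auto simp: labelling.blocks_def[OF assms(1)] labelling.blocks_def[OF assms(2)]
      labelling.block_def[OF assms(1)] labelling.block_def[OF assms(2)])

text \<open>Positions count from \<open>1\<close> and list indices from \<open>0\<close>, whence
  \<open>p - 1\<close>.\<close>

lemma labelling_list: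
  assumes "set is = {..<k}" "length is = n"
  shows "labelling n k (\<lambda>p. is ! (p - 1))"
proof
  have "(\<lambda>p. p - 1) ` {1..n} = {..<n}"
  proof
    show "{..<n} \<subseteq> (\<lambda>p. p - 1) ` {1..n}"
    proof
      fix x assume "x \<in> {..<n}"
      then show "x \<in> (\<lambda>p. p - 1) ` {1..n}" by (intro image_eqI[of _ _ "Suc x"]) auto
    qed
  qed auto
  then have "(\<lambda>p. is ! (p - 1)) ` {1..n} = (!) is ` {..<n}"
    by (metis image_image)
  then show "(\<lambda>p. is ! (p - 1)) ` {1..n} = {..<k}"
    using assms by (auto simp: set_conv_nth)
qed

text \<open>Lists of length \<open>n\<close> with entry set \<open>{..<k}\<close> are the labellings
  with \<open>k\<close> labels; \<open>T\<close> and \<open>T'\<close> below translate between them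
  and the ordered partitions with \<open>k\<close> blocks.\<close>

lemma sum_labellings:
  fixes f :: "nat \<Rightarrow> nat list \<Rightarrow> complex"
  shows "(\<Sum>k\<le>n. \<Sum>is | set is = {..<k} \<and> length is = n. f k is) =
    (\<Sum>\<pi>\<in>ordered_partitions n. f (length \<pi>) (map (label_of \<pi>) [1..<Suc n]))"
    and finite_ordered_partitions: "finite (ordered_partitions n)"
proof -
  define L where "L = Sigma {..n} (\<lambda>k. {is. set is = {..<k} \<and> length is = n})"
  define T where "T = (\<lambda>(k, is). labelling.blocks n k (\<lambda>p. is ! (p - 1)))"
  define T' where "T' = (\<lambda>\<pi>. (length \<pi>, map (label_of \<pi>) [1..<Suc n]))"
  have list: "map (\<lambda>p. is ! (p - 1)) [1..<Suc n] = is" if "length is = n" for "is" :: "nat list"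
    using that by (intro nth_equalityI) (auto simp del: upt_Suc)
  have T: "T x \<in> ordered_partitions n" "T' (T x) = x" if L: "x \<in> L" for x
  proof -
    obtain k "is" where x: "x = (k, is)" "set is = {..<k}" "length is = n"
      using L by (auto simp: L_def)
    interpret labelling n k "\<lambda>p. is ! (p - 1)" using x(2,3) by (rule labelling_list)
    show "T x \<in> ordered_partitions n"
      using distinct_blocks partition_blocks by (simp add: T_def x ordered_partitions_def)
    have "map (label_of blocks) [1..<Suc n] = map (\<lambda>p. is ! (p - 1)) [1..<Suc n]"
      by (intro map_cong refl label_of_blocks[OF labelling_axioms]) auto
    also have "\<dots> = is" by (rule list[OF x(3)])
    finally have map: "map (label_of blocks) [1..<Suc n] = is" .
    have "length blocks = k" unfolding blocks_def by simp
    then show "T' (T x) = x"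
      unfolding T_def T'_def x(1) prod.case map by (simp only:)
  qed
  have T': "T' \<pi> \<in> L" "T (T' \<pi>) = \<pi>" if \<pi>: "\<pi> \<in> ordered_partitions n" for \<pi>
  proof -
    interpret labelling n "length \<pi>" "label_of \<pi>" using \<pi> by (rule labelling_label_of)
    have set: "set (map (label_of \<pi>) [1..<Suc n]) = {..<length \<pi>}"
      using lab_image by (simp add: atLeastLessThanSuc_atLeastAtMost del: upt_Suc)
    then have "length \<pi> \<le> n"
      using card_length[of "map (label_of \<pi>) [1..<Suc n]"] by (simp del: upt_Suc)
    then show "T' \<pi> \<in> L" using set by (simp add: T'_def L_def del: upt_Suc)
    have "blocks = labelling.blocks n (length \<pi>) (\<lambda>p. map (label_of \<pi>) [1..<Suc n] ! (p - 1))"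
      using set by (intro blocks_cong labelling_axioms labelling_list) (auto simp del: upt_Suc)
    then show "T (T' \<pi>) = \<pi>"
      using blocks_label_of[OF \<pi>] by (simp add: T_def T'_def del: upt_Suc)
  qed
  have finite: "finite {is. set is = {..<k} \<and> length is = n}" for k :: nat
    by (rule finite_subset[OF _ finite_lists_length_eq[of "{..<k}" n]]) auto
  have "(\<Sum>k\<le>n. \<Sum>is | set is = {..<k} \<and> length is = n. f k is) = (\<Sum>(k, is)\<in>L. f k is)"
    unfolding L_def using finite by (subst sum.Sigma) auto
  also have "\<dots> = (\<Sum>\<pi>\<in>ordered_partitions n. f (length \<pi>) (map (label_of \<pi>) [1..<Suc n]))"
    by (rule sum.reindex_bij_witness[of _ T' T])
      (use T T' in \<open>auto simp: T'_def split: prod.splits simp del: upt_Suc\<close>)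
  finally show "(\<Sum>k\<le>n. \<Sum>is | set is = {..<k} \<and> length is = n. f k is) =
    (\<Sum>\<pi>\<in>ordered_partitions n. f (length \<pi>) (map (label_of \<pi>) [1..<Suc n]))" .
  have "ordered_partitions n \<subseteq> T ` L" using T' by (metis image_eqI subsetI)
  moreover have "finite L" unfolding L_def using finite by auto
  ultimately show "finite (ordered_partitions n)" by (metis finite_imageI finite_subset)
qed

section \<open>The moment-cumulant formula\<close>

context functional_pair
begin

text \<open>One formula for any unital \<open>\<chi>\<close> at the bottom of the stack, which is
  the functional of the outer blocks. Crossing partitions contribute \<open>0\<close>, noncrossing
  ones their block weight.\<close>

lemma moment_cumulant_formula:
  assumes "unital_functional \<chi>"
  shows "\<chi> (prod_list (map a [1..<Suc n])) =
    (\<Sum>\<pi>\<in>ONC n. 1 / fact (length \<pi>) * block_weight \<chi> a \<pi>)"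
proof -
  let ?as = "map a [1..<Suc n]"
  let ?v = "\<lambda>\<pi>. linear_run \<chi> (map (\<lambda>p. (label_of \<pi> p, a p)) [1..<Suc n]) []"
  have "\<chi> (prod_list ?as) =
      (\<Sum>k\<le>n. \<Sum>is | set is = {..<k} \<and> length is = n. linear_run \<chi> (zip is ?as) [] / fact k)"
    using unital_moment_formula[OF assms, of ?as]
    by (simp add: sum_divide_distrib del: upt_Suc)
  also have "\<dots> = (\<Sum>\<pi>\<in>ordered_partitions n. ?v \<pi> / fact (length \<pi>))"
    unfolding sum_labellings by (simp add: zip_map_map zip_same_conv_map comp_def del: upt_Suc)
  also have "\<dots> = (\<Sum>\<pi>\<in>ONC n. ?v \<pi> / fact (length \<pi>))"
  proof (rule sum.mono_neutral_right[OF finite_ordered_partitions])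
    show "ONC n \<subseteq> ordered_partitions n"
      by (auto simp: ONC_def ordered_partitions_def)
    show "\<forall>\<pi>\<in>ordered_partitions n - ONC n. ?v \<pi> / fact (length \<pi>) = 0"
    proof
      fix \<pi> assume "\<pi> \<in> ordered_partitions n - ONC n"
      then have \<pi>: "\<pi> \<in> ordered_partitions n" "\<not> noncrossing (set \<pi>)"
        by (auto simp: ONC_def ordered_partitions_def)
      then show "?v \<pi> / fact (length \<pi>) = 0"
        using linear_run_crossing_labelling[OF labelling_label_of[OF \<pi>(1)]]
        by (simp add: blocks_label_of del: upt_Suc)
    qed
  qed
  also have "\<dots> = (\<Sum>\<pi>\<in>ONC n. 1 / fact (length \<pi>) * block_weight \<chi> a \<pi>)"
  proof (rule sum.cong)
    fix \<pi> assume "\<pi> \<in> ONC n"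
    then have \<pi>: "\<pi> \<in> ordered_partitions n" "noncrossing (set \<pi>)"
      by (auto simp: ONC_def ordered_partitions_def)
    interpret noncrossing_labelling n "length \<pi>" "label_of \<pi>"
      using \<pi> by (intro labelling.noncrossing_labellingI labelling_label_of)
        (simp_all add: blocks_label_of)
    interpret labelled_run \<psi> \<theta> n "length \<pi>" "label_of \<pi>" a \<chi> ..
    show "?v \<pi> / fact (length \<pi>) = 1 / fact (length \<pi>) * block_weight \<chi> a \<pi>"
      using linear_run_block_weight blocks_label_of[OF \<pi>(1)]
      by (simp add: remaining_def del: upt_Suc)
  qed simp
  finally show ?thesis .
qed

lemma cumulant_eq:
  assumes "unital_functional \<phi>"
  shows "alpha_cumulant \<phi> \<psi> \<theta> = cumulant \<phi>" "beta_cumulant \<phi> \<psi> \<theta> = cumulant \<psi>"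
    "gamma_cumulant \<phi> \<psi> \<theta> = cumulant \<theta>"
  using assms unital_\<psi> unital_\<theta>
  by (simp_all add: fun_eq_iff alpha_cumulant_def beta_cumulant_def gamma_cumulant_def
      alpha_free_product_eq state_dot cumulant_def)

end

theorem theorem4p16:
  fixes \<phi> \<psi> \<theta> :: "'a::complex_algebra_1 \<Rightarrow> complex"
    and a :: "nat \<Rightarrow> 'a" and n :: nat
  assumes "unital_functional \<phi>" and "unital_functional \<psi>" and "unital_functional \<theta>"
    and "n \<ge> 1"
  shows "\<phi> (prod_list (map a [1..<Suc n])) =
           (\<Sum>\<pi>\<in>ONC n. 1 / fact (length \<pi>) *
              (\<Prod>P\<in>outer_blocks \<pi>. alpha_cumulant \<phi> \<psi> \<theta> (restrict_tuple a P)) *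
              (\<Prod>P\<in>B_blocks \<pi>. beta_cumulant \<phi> \<psi> \<theta> (restrict_tuple a P)) *
              (\<Prod>P\<in>C_blocks \<pi>. gamma_cumulant \<phi> \<psi> \<theta> (restrict_tuple a P)))
       \<and> \<psi> (prod_list (map a [1..<Suc n])) =
           (\<Sum>\<pi>\<in>ONC n. 1 / fact (length \<pi>) *
              (\<Prod>P\<in>outer_blocks \<pi> \<union> B_blocks \<pi>. beta_cumulant \<phi> \<psi> \<theta> (restrict_tuple a P)) *
              (\<Prod>P\<in>C_blocks \<pi>. gamma_cumulant \<phi> \<psi> \<theta> (restrict_tuple a P)))
       \<and> \<theta> (prod_list (map a [1..<Suc n])) =
           (\<Sum>\<pi>\<in>ONC n. 1 / fact (length \<pi>) *
              (\<Prod>P\<in>B_blocks \<pi>. beta_cumulant \<phi> \<psi> \<theta> (restrict_tuple a P)) *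
              (\<Prod>P\<in>outer_blocks \<pi> \<union> C_blocks \<pi>. gamma_cumulant \<phi> \<psi> \<theta> (restrict_tuple a P)))"
proof -
  interpret functional_pair \<psi> \<theta> using assms(2,3) by unfold_locales
  have fin: "finite (outer_blocks \<pi>)" "finite (B_blocks \<pi>)" "finite (C_blocks \<pi>)" for \<pi>
    by (auto simp: outer_blocks_def B_blocks_def C_blocks_def inner_blocks_def)
  have "outer_blocks \<pi> \<inter> B_blocks \<pi> = {}" "outer_blocks \<pi> \<inter> C_blocks \<pi> = {}" for \<pi>
    by (auto simp: outer_blocks_def B_blocks_def C_blocks_def)
  \<comment> \<open>In the formulas for \<psi> and \<theta> the outer blocks carry the same cumulant
    as \<open>B_blocks\<close> and \<open>C_blocks\<close> respectively, so two of the three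
    products merge.\<close>
  then have union: "(\<Prod>P\<in>outer_blocks \<pi> \<union> B_blocks \<pi>. h P) =
      (\<Prod>P\<in>outer_blocks \<pi>. h P) * (\<Prod>P\<in>B_blocks \<pi>. h P)"
    "(\<Prod>P\<in>outer_blocks \<pi> \<union> C_blocks \<pi>. h P) =
      (\<Prod>P\<in>outer_blocks \<pi>. h P) * (\<Prod>P\<in>C_blocks \<pi>. h P)" for \<pi> and h :: "nat set \<Rightarrow> complex"
    by (simp_all add: prod.union_disjoint fin)
  show ?thesis
    using moment_cumulant_formula[OF assms(1), of a n] moment_cumulant_formula[OF assms(2), of a n]
      moment_cumulant_formula[OF assms(3), of a n]
    by (simp add: cumulant_eq[OF assms(1)] union block_weight_def mult_ac del: upt_Suc)
qed

end
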